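(* Let $(x_k)_{k\ge0}$ be generated by the MTA algorithm applied to problem (P), under Assumptions 1, 2, 3 and 4 of the context, with $x_0\in\mathcal F$, $M_p>L_p$, $M>0$ and $M_q^i\ge L_q^i+\eta_3$ for all $i=1,\dots,m$. Then there exist $\Lambda_{k+1}\in\partial h(x_{k+1})$ ($k\ge 0$) such that, with $\mathcal M$, $C_1$, $C_2$, $C$ as defined in the context: (i) For all $k\ge 0$, $$\mathcal M(x_{k+1})\le C_1\|x_{k+1}-x_k\|^p+\eta_1\|x_{k+1}-x_k\|^{\min(p,q)}+C_2\|x_{k+1}-x_k\|^q .$$ Consequently, if $x_{k+1}=x_k$, then $x_k$ is a KKT point of problem (P), i.e. $x_k\in\mathcal S$. (ii) The sequence $(\mathcal M(x_k))_k$ converges to $0$ with the following sublinear rate: for all $k\ge1$, $$\min_{j=1,\dots,k}\mathcal M(x_j)\le \frac{C}{k^{\min\left(\frac{q}{q+1},\frac{p}{p+1}\right)}} .$$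
   Context: Setting. $\mathbb E$ is a finite-dimensional real vector space with dual $\mathbb E^*$; $B:\mathbb E\to\mathbb E^*$ is self-adjoint positive definite, $\|x\|=\langle Bx,x\rangle^{1/2}$ on $\mathbb E$ and $\|g\|_*=\langle g,B^{-1}g\rangle^{1/2}$ on $\mathbb E^*$ (also written $\|g\|$). $p,q\ge1$ are integers. For a symmetric $p$-linear form, $\|D^p\phi(x)\|=\max\{D^p\phi(x)[d]^p:\|d\|\le1\}$. The Taylor approximation of order $p$ of $\phi$ at $x$ is $T_p^\phi(y;x)=\phi(x)+\sum_{i=1}^p\frac1{i!}D^i\phi(x)[y-x]^i$. Problem (P): minimize $F(x):=F_0(x)+h(x)$ over $x\in\mathbb E$ subject to $F_i(x)\le0$, $i=1,\dots,m$. Feasible set $\mathcal F=\{x\in\mathbb E:F_i(x)\le0,\ i=1,\dots,m\}$. Assumption 1: $F_0:\mathbb E\to\mathbb R$ (possibly nonconvex) is $p$ times continuously differentiable with $\|D^pF_0(x)-D^pF_0(y)\|\le L_p\|x-y\|$ for all $x,y$; each $F_i:\mathbb E\to\mathbb R$, $i=1,\dots,m$ (possibly nonconvex), is $q$ times continuously differentiable with $\|D^qF_i(x)-D^qF_i(y)\|\le L_q^i\|x-y\|$ for all $x,y$; $h$ is (simple) proper, convex and locally Lipschitz continuous. Assumption 2: $\mathcal F\ne\emptyset$ and, for any fixed $x_0\in\mathcal F$, the set $\mathcal A(x_0)=\{x\in\mathcal F:F(x)\le F(x_0)\}$ is bounded. Assumption 3 (MFCQ): for every $x\in\mathcal F$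 there is $d\in\mathbb E$ with $\langle\nabla F_i(x),d\rangle<0$ for all $i\in I(x):=\{i:F_i(x)=0\}$. Models: $s_{M_p}^M(y;x)=T_p^{F_0}(y;x)+\frac{M_p}{(p+1)!}\|y-x\|^{p+1}+\frac{M}{(q+1)!}\|y-x\|^{q+1}$ and $s_{M_q^i}(y;x)=T_q^{F_i}(y;x)+\frac{M_q^i}{(q+1)!}\|y-x\|^{q+1}$; gradients $\nabla s$ are with respect to the first argument $y$. MTA algorithm: given $x_0\in\mathcal F$, for each $k\ge0$ compute $x_{k+1}$, an approximate stationary point of the subproblem $\min_{x}\ s_{M_p}^M(x;x_k)+h(x)$ subject to $s_{M_q^i}(x;x_k)\le0$, $i=1,\dots,m$, in the sense of Assumption 4, satisfying also the descent $s_{M_p}^M(x_{k+1};x_k)+h(x_{k+1})\le F(x_k)$. Assumption 4 (A-KKT): given $\eta_1,\eta_2,\eta_3>0$, for each $k\ge 0$ there exist multipliers $u^{k+1}=(u_1^{k+1},\dots,u_m^{k+1})\ge0$ and $\Lambda_{k+1}\in\partial h(x_{k+1})$ such that $\|\nabla s_{M_p}^M(x_{k+1};x_k)+\Lambda_{k+1}+\sum_{i=1}^mu_i^{k+1}\nabla s_{M_q^i}(x_{k+1};x_k)\|\le\eta_1\|x_{k+1}-x_k\|^{\min(p,q)}$, and for all $i=1,\dots,m$: $|u_i^{k+1}s_{M_q^i}(x_{k+1};x_k)|\le\frac{\eta_2}{(q+1)!}\|x_{k+1}-x_k\|^{q+1}$ and $\max(0,s_{M_q^i}(x_{k+1};x_k))\le\frac{\eta_3}{(q+1)!}\|x_{k+1}-x_k\|^{q+1}$.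 Under these hypotheses $(x_k)$ and $(u^k)$ are bounded and $(F(x_k))$ is nonincreasing and convergent; $D>0$ denotes a constant with $\|x_k\|\le D$ for all $k$, $C_u>0$ a constant with $\|u^k\|\le C_u$ for all $k\ge 1$, and $F_\infty=\lim_kF(x_k)$. KKT points of (P): $\mathcal S=\{x\in\mathcal F:\exists u_i\ge0,\ \Lambda\in\partial h(x)\text{ with }\nabla F_0(x)+\Lambda+\sum_{i=1}^mu_i\nabla F_i(x)=0,\ u_iF_i(x)=0,\ i=1,\dots,m\}$. Optimality measure (with $u^{k+1}$ the multipliers from Assumption 4 and $\Lambda_{k+1}\in\partial h(x_{k+1})$): $$\mathcal M(x_{k+1})=\max\Big\{\big\|\nabla F_0(x_{k+1})+\Lambda_{k+1}+\sum_{i=1}^mu_i^{k+1}\nabla F_i(x_{k+1})\big\|,\ \big(-u_i^{k+1}F_i(x_{k+1})\big)^{\frac q{q+1}},\ i=1,\dots,m\Big\}.$$ Constants: $C_1=\frac{L_p+M_p}{p!}$, $C_2=\frac{C_u\sum_{i=1}^m(M_q^i+L_q^i)+M}{q!}+\Big(C_u\max_{i=1,\dots,m}\frac{M_q^i+L_q^i}{(q+1)!}+\frac{\eta_2}{(q+1)!}\Big)^{\frac q{q+1}}$, and $$C=\max\Big(\tfrac{((q+1)!)^{\frac q{q+1}}(C_1(2D)^{p-q}+\eta_1+C_2)(F(x_0)-F_\infty)^{\frac q{q+1}}}{M^{\frac q{q+1}}},\ \tfrac{((p+1)!)^{\frac p{p+1}}(C_1+\eta_1+C_2(2D)^{q-p})(F(x_0)-F_\infty)^{\frac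 p{p+1}}}{(M_p-L_p)^{\frac p{p+1}}}\Big).$$ *)

theory Defs
  imports "HOL-Analysis.Analysis"
begin

section \<open>The space and its norms\<close>

text \<open>
  The space is an arbitrary \<^class>\<open>euclidean_space\<close>, used only as a finite-dimensional real
  vector space with its topology. The dual is the type \<open>'a \<Rightarrow>\<^sub>L real\<close>, which in finite dimension
  contains all linear functionals. All norms of the problem come from the operator \<open>B\<close> and in
  general differ from the norm of the type class.
\<close>

definition pos_def_operator :: "('a::euclidean_space \<Rightarrow> 'a \<Rightarrow>\<^sub>L real) \<Rightarrow> bool" where
  "pos_def_operator B \<longleftrightarrow>
     linear B \<and> (\<forall>x y. blinfun_apply (B x) y = blinfun_apply (B y) x) \<and>
     (\<forall>x. x \<noteq> 0 \<longrightarrow> blinfun_apply (B x) x > 0)"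

definition pnorm :: "('a::euclidean_space \<Rightarrow> 'a \<Rightarrow>\<^sub>L real) \<Rightarrow> 'a \<Rightarrow> real" where
  "pnorm B x = sqrt (blinfun_apply (B x) x)"

definition dnorm :: "('a::euclidean_space \<Rightarrow> 'a \<Rightarrow>\<^sub>L real) \<Rightarrow> ('a \<Rightarrow>\<^sub>L real) \<Rightarrow> real" where
  "dnorm B g = sqrt (blinfun_apply g (inv B g))"


section \<open>Derivatives and Taylor models\<close>

definition grad :: "('a::euclidean_space \<Rightarrow> real) \<Rightarrow> 'a \<Rightarrow> 'a \<Rightarrow>\<^sub>L real" where
  "grad f x = Blinfun (frechet_derivative f (at x))"

text \<open>
  \<open>nderiv f [d\<^sub>1, \<dots>, d\<^sub>i] x\<close> is the value of the \<open>i\<close>-linear form \<open>D\<^sup>i f(x)\<close> at \<open>d\<^sub>1, \<dots>, d\<^sub>i\<close>. Since the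
  space is finite-dimensional, the derivative of a map into multilinear forms is computed,
  and its existence and continuity can be tested, for each fixed tuple of arguments.
\<close>

primrec nderiv :: "('a::euclidean_space \<Rightarrow> real) \<Rightarrow> 'a list \<Rightarrow> 'a \<Rightarrow> real" where
  "nderiv f [] = f"
| "nderiv f (d # ds) = (\<lambda>x. frechet_derivative (nderiv f ds) (at x) d)"

definition cont_diff :: "nat \<Rightarrow> ('a::euclidean_space \<Rightarrow> real) \<Rightarrow> bool" where
  "cont_diff n f \<longleftrightarrow>
     (\<forall>ds. length ds < n \<longrightarrow> (\<forall>x. nderiv f ds differentiable (at x))) \<and>
     (\<forall>ds. length ds \<le> n \<longrightarrow> continuous_on UNIV (nderiv f ds))"

text \<open>
  The norm \<open>max {A[d]\<^sup>n : \<parallel>d\<parallel> \<le> 1}\<close> of an \<open>n\<close>-linear form. There is no absolute value around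
  \<open>A[d]\<^sup>n\<close>; in \<open>lipschitz_deriv\<close> this makes no difference, because the condition there is
  imposed on both \<open>(x, y)\<close> and \<open>(y, x)\<close>.
\<close>

definition form_norm ::
  "('a::euclidean_space \<Rightarrow> 'a \<Rightarrow>\<^sub>L real) \<Rightarrow> nat \<Rightarrow> ('a list \<Rightarrow> real) \<Rightarrow> real" where
  "form_norm B n A = Sup ((\<lambda>d. A (replicate n d)) ` {d. pnorm B d \<le> 1})"

definition lipschitz_deriv ::
  "('a::euclidean_space \<Rightarrow> 'a \<Rightarrow>\<^sub>L real) \<Rightarrow> nat \<Rightarrow> real \<Rightarrow> ('a \<Rightarrow> real) \<Rightarrow> bool" where
  "lipschitz_deriv B n L f \<longleftrightarrow>
     (\<forall>x y. form_norm B n (\<lambda>ds. nderiv f ds x - nderiv f ds y) \<le> L * pnorm B (x - y))"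

definition taylor :: "nat \<Rightarrow> ('a::euclidean_space \<Rightarrow> real) \<Rightarrow> 'a \<Rightarrow> 'a \<Rightarrow> real" where
  "taylor n f y x = f x + (\<Sum>i = 1..n. nderiv f (replicate i (y - x)) x / fact i)"

definition obj_model ::
  "('a::euclidean_space \<Rightarrow> 'a \<Rightarrow>\<^sub>L real) \<Rightarrow> nat \<Rightarrow> nat \<Rightarrow> real \<Rightarrow> real \<Rightarrow> ('a \<Rightarrow> real) \<Rightarrow> 'a \<Rightarrow> 'a \<Rightarrow> real" where
  "obj_model B p q Mp M F0 y x =
     taylor p F0 y x + Mp / fact (p + 1) * pnorm B (y - x) ^ (p + 1)
       + M / fact (q + 1) * pnorm B (y - x) ^ (q + 1)"

definition con_model ::
  "('a::euclidean_space \<Rightarrow> 'a \<Rightarrow>\<^sub>L real) \<Rightarrow> nat \<Rightarrow> real \<Rightarrow> ('a \<Rightarrow> real) \<Rightarrow> 'a \<Rightarrow> 'a \<Rightarrow> real" where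
  "con_model B q Mq f y x = taylor q f y x + Mq / fact (q + 1) * pnorm B (y - x) ^ (q + 1)"


section \<open>The nonsmooth convex term\<close>

text \<open>
  \<open>h\<close> is extended-valued, and its Lipschitz continuity is required on its effective domain;
  a finite-valued \<open>h\<close> is the case where the domain is the whole space.
\<close>

definition edom :: "('a \<Rightarrow> ereal) \<Rightarrow> 'a set" where
  "edom h = {x. h x < \<infinity>}"

definition proper_fun :: "('a \<Rightarrow> ereal) \<Rightarrow> bool" where
  "proper_fun h \<longleftrightarrow> edom h \<noteq> {} \<and> (\<forall>x. h x \<noteq> -\<infinity>)"

definition convex_ext :: "('a::euclidean_space \<Rightarrow> ereal) \<Rightarrow> bool" where
  "convex_ext h \<longleftrightarrow> convex_on (edom h) (\<lambda>x. real_of_ereal (h x))"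

definition locally_lipschitz_ext :: "('a::euclidean_space \<Rightarrow> ereal) \<Rightarrow> bool" where
  "locally_lipschitz_ext h \<longleftrightarrow>
     (\<forall>x \<in> edom h. \<exists>r > 0. \<exists>L. L-lipschitz_on (cball x r \<inter> edom h) (\<lambda>z. real_of_ereal (h z)))"

definition subdiff :: "('a::euclidean_space \<Rightarrow> ereal) \<Rightarrow> 'a \<Rightarrow> ('a \<Rightarrow>\<^sub>L real) set" where
  "subdiff h x = {g. \<forall>y. h x + ereal (blinfun_apply g (y - x)) \<le> h y}"


section \<open>The problem and its assumptions\<close>

definition objective :: "('a \<Rightarrow> real) \<Rightarrow> ('a \<Rightarrow> ereal) \<Rightarrow> 'a \<Rightarrow> ereal" where
  "objective F0 h x = ereal (F0 x) + h x"

definition feasible :: "nat \<Rightarrow> (nat \<Rightarrow> 'a \<Rightarrow> real) \<Rightarrow> 'a set" where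
  "feasible m Fc = {x. \<forall>i \<in> {1..m}. Fc i x \<le> 0}"

definition smoothness_assumption ::
  "('a::euclidean_space \<Rightarrow> 'a \<Rightarrow>\<^sub>L real) \<Rightarrow> nat \<Rightarrow> nat \<Rightarrow> nat \<Rightarrow> real \<Rightarrow> (nat \<Rightarrow> real) \<Rightarrow>
   ('a \<Rightarrow> real) \<Rightarrow> (nat \<Rightarrow> 'a \<Rightarrow> real) \<Rightarrow> ('a \<Rightarrow> ereal) \<Rightarrow> bool" where
  "smoothness_assumption B p q m Lp Lq F0 Fc h \<longleftrightarrow>
     cont_diff p F0 \<and> lipschitz_deriv B p Lp F0 \<and>
     (\<forall>i \<in> {1..m}. cont_diff q (Fc i) \<and> lipschitz_deriv B q (Lq i) (Fc i)) \<and>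
     proper_fun h \<and> convex_ext h \<and> locally_lipschitz_ext h"

definition level_set_assumption ::
  "nat \<Rightarrow> ('a::euclidean_space \<Rightarrow> real) \<Rightarrow> (nat \<Rightarrow> 'a \<Rightarrow> real) \<Rightarrow> ('a \<Rightarrow> ereal) \<Rightarrow> bool" where
  "level_set_assumption m F0 Fc h \<longleftrightarrow>
     feasible m Fc \<noteq> {} \<and>
     (\<forall>z \<in> feasible m Fc \<inter> edom h.
        bounded {x \<in> feasible m Fc. objective F0 h x \<le> objective F0 h z})"

definition mfcq :: "nat \<Rightarrow> (nat \<Rightarrow> 'a::euclidean_space \<Rightarrow> real) \<Rightarrow> bool" where
  "mfcq m Fc \<longleftrightarrow>
     (\<forall>x \<in> feasible m Fc. \<exists>d. \<forall>i \<in> {1..m}. Fc i x = 0 \<longrightarrow> blinfun_apply (grad (Fc i) x) d < 0)"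

definition kkt_points ::
  "nat \<Rightarrow> ('a::euclidean_space \<Rightarrow> real) \<Rightarrow> (nat \<Rightarrow> 'a \<Rightarrow> real) \<Rightarrow> ('a \<Rightarrow> ereal) \<Rightarrow> 'a set" where
  "kkt_points m F0 Fc h =
     {x \<in> feasible m Fc. \<exists>v \<Lambda>. \<Lambda> \<in> subdiff h x \<and> (\<forall>i \<in> {1..m}. v i \<ge> 0) \<and>
        grad F0 x + \<Lambda> + (\<Sum>i = 1..m. v i *\<^sub>R grad (Fc i) x) = 0 \<and>
        (\<forall>i \<in> {1..m}. v i * Fc i x = 0)}"


section \<open>The algorithm\<close>

text \<open>\<open>a_kkt \<dots> x y v \<Lambda>\<close>: from the iterate \<open>x\<close>, the point \<open>y\<close> is approximately stationary for the
  subproblem at \<open>x\<close>, with multipliers \<open>v\<close> and subgradient \<open>\<Lambda>\<close>.\<close>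

definition a_kkt ::
  "('a::euclidean_space \<Rightarrow> 'a \<Rightarrow>\<^sub>L real) \<Rightarrow> nat \<Rightarrow> nat \<Rightarrow> nat \<Rightarrow> real \<Rightarrow> real \<Rightarrow> (nat \<Rightarrow> real) \<Rightarrow>
   real \<Rightarrow> real \<Rightarrow> real \<Rightarrow> ('a \<Rightarrow> real) \<Rightarrow> (nat \<Rightarrow> 'a \<Rightarrow> real) \<Rightarrow> ('a \<Rightarrow> ereal) \<Rightarrow>
   'a \<Rightarrow> 'a \<Rightarrow> (nat \<Rightarrow> real) \<Rightarrow> ('a \<Rightarrow>\<^sub>L real) \<Rightarrow> bool" where
  "a_kkt B p q m Mp M Mq \<eta>1 \<eta>2 \<eta>3 F0 Fc h x y v \<Lambda> \<longleftrightarrow>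
     (\<forall>i \<in> {1..m}. v i \<ge> 0) \<and> \<Lambda> \<in> subdiff h y \<and>
     dnorm B (grad (\<lambda>z. obj_model B p q Mp M F0 z x) y + \<Lambda>
              + (\<Sum>i = 1..m. v i *\<^sub>R grad (\<lambda>z. con_model B q (Mq i) (Fc i) z x) y))
       \<le> \<eta>1 * pnorm B (y - x) ^ min p q \<and>
     (\<forall>i \<in> {1..m}.
        \<bar>v i * con_model B q (Mq i) (Fc i) y x\<bar> \<le> \<eta>2 / fact (q + 1) * pnorm B (y - x) ^ (q + 1) \<and>
        max 0 (con_model B q (Mq i) (Fc i) y x) \<le> \<eta>3 / fact (q + 1) * pnorm B (y - x) ^ (q + 1))"

text \<open>\<open>u k\<close> is the multiplier vector of the step that produces \<open>x k\<close>, so \<open>u 0\<close> is irrelevant.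
  Every quantity below needs a finite starting value \<open>F(x\<^sub>0)\<close>, hence \<open>x 0 \<in> edom h\<close>.\<close>

definition mta_sequence ::
  "('a::euclidean_space \<Rightarrow> 'a \<Rightarrow>\<^sub>L real) \<Rightarrow> nat \<Rightarrow> nat \<Rightarrow> nat \<Rightarrow> real \<Rightarrow> real \<Rightarrow> (nat \<Rightarrow> real) \<Rightarrow>
   real \<Rightarrow> real \<Rightarrow> real \<Rightarrow> ('a \<Rightarrow> real) \<Rightarrow> (nat \<Rightarrow> 'a \<Rightarrow> real) \<Rightarrow> ('a \<Rightarrow> ereal) \<Rightarrow>
   (nat \<Rightarrow> 'a) \<Rightarrow> (nat \<Rightarrow> nat \<Rightarrow> real) \<Rightarrow> bool" where
  "mta_sequence B p q m Mp M Mq \<eta>1 \<eta>2 \<eta>3 F0 Fc h x u \<longleftrightarrow>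
     x 0 \<in> feasible m Fc \<and> x 0 \<in> edom h \<and>
     (\<forall>k. (\<exists>\<Lambda>. a_kkt B p q m Mp M Mq \<eta>1 \<eta>2 \<eta>3 F0 Fc h (x k) (x (Suc k)) (u (Suc k)) \<Lambda>) \<and>
          ereal (obj_model B p q Mp M F0 (x (Suc k)) (x k)) + h (x (Suc k))
            \<le> objective F0 h (x k))"


section \<open>Optimality measure and constants\<close>

definition opt_measure ::
  "('a::euclidean_space \<Rightarrow> 'a \<Rightarrow>\<^sub>L real) \<Rightarrow> nat \<Rightarrow> nat \<Rightarrow> ('a \<Rightarrow> real) \<Rightarrow> (nat \<Rightarrow> 'a \<Rightarrow> real) \<Rightarrow>
   'a \<Rightarrow> (nat \<Rightarrow> real) \<Rightarrow> ('a \<Rightarrow>\<^sub>L real) \<Rightarrow> real" where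
  "opt_measure B q m F0 Fc x v \<Lambda> =
     Max (insert (dnorm B (grad F0 x + \<Lambda> + (\<Sum>i = 1..m. v i *\<^sub>R grad (Fc i) x)))
                 ((\<lambda>i. (- (v i * Fc i x)) powr (real q / real (q + 1))) ` {1..m}))"

definition const_C1 :: "nat \<Rightarrow> real \<Rightarrow> real \<Rightarrow> real" where
  "const_C1 p Lp Mp = (Lp + Mp) / fact p"

definition const_C2 ::
  "nat \<Rightarrow> nat \<Rightarrow> (nat \<Rightarrow> real) \<Rightarrow> (nat \<Rightarrow> real) \<Rightarrow> real \<Rightarrow> real \<Rightarrow> real \<Rightarrow> real" where
  "const_C2 q m Lq Mq M \<eta>2 Cu =
     (Cu * (\<Sum>i = 1..m. Mq i + Lq i) + M) / fact q
     + (Cu * (MAX i \<in> {1..m}. (Mq i + Lq i) / fact (q + 1)) + \<eta>2 / fact (q + 1))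
         powr (real q / real (q + 1))"

text \<open>\<open>\<delta>\<close> stands for \<open>F(x\<^sub>0) - F\<^sub>\<infinity>\<close>. The exponents of \<open>2 * D\<close> may be negative.\<close>

definition const_C ::
  "nat \<Rightarrow> nat \<Rightarrow> real \<Rightarrow> real \<Rightarrow> real \<Rightarrow> real \<Rightarrow> real \<Rightarrow> real \<Rightarrow> real \<Rightarrow> real \<Rightarrow> real" where
  "const_C p q Lp Mp M \<eta>1 D C1 C2 \<delta> =
     (let a = real q / real (q + 1); b = real p / real (p + 1) in
      max (fact (q + 1) powr a * (C1 * (2 * D) powr (real p - real q) + \<eta>1 + C2) * \<delta> powr a
             / M powr a)
          (fact (p + 1) powr b * (C1 + \<eta>1 + C2 * (2 * D) powr (real q - real p)) * \<delta> powr b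
             / (Mp - Lp) powr b))"

end

theory Submission
  imports Defs
begin

text \<open>
  The models are Taylor polynomials plus multiples of powers of the norm, so everything rests on two
  remainder estimates for a function whose \<open>n\<close>-th derivative is \<open>L\<close>-Lipschitz: the value of the
  function differs from its Taylor polynomial by at most \<open>L r\<^sup>n\<^sup>+\<^sup>1 / (n + 1)!\<close>, and the gradient by at
  most \<open>L r\<^sup>n / n!\<close> in the dual norm. The Lipschitz condition only controls the derivative form on
  the diagonal, whereas the gradient estimate evaluates it at \<open>(v, \<dots>, v, d)\<close>. That the constant
  does not deteriorate is Banach's theorem: on a Euclidean space the norm of a symmetric multilinear
  form is attained on the diagonal.

  Given these estimates, (i) follows by replacing the model gradients and values in the approximate
  KKT conditions. For (ii), every step decreases \<open>F\<close> by at least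
  \<open>(M\<^sub>p - L\<^sub>p) r\<^sup>p\<^sup>+\<^sup>1 / (p + 1)! + M r\<^sup>q\<^sup>+\<^sup>1 / (q + 1)!\<close>; the sum of the first \<open>k\<close> decreases is
  at most \<open>F(x\<^sub>0) - F\<^sub>\<infinity>\<close>, which bounds the smallest step. The bound of (i) is homogenised to the
  power \<open>min p q\<close> of the step by means of \<open>r \<le> 2 D\<close>.
\<close>

subsection \<open>The norms of a positive definite operator\<close>

locale pos_def =
  fixes B :: "'a::euclidean_space \<Rightarrow> 'a \<Rightarrow>\<^sub>L real"
  assumes pos_def: "pos_def_operator B"
begin

abbreviation ip :: "'a \<Rightarrow> 'a \<Rightarrow> real" where
  "ip x y \<equiv> blinfun_apply (B x) y"

abbreviation pn :: "'a \<Rightarrow> real" where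
  "pn \<equiv> pnorm B"

lemma bounded_linear_B: "bounded_linear B"
  using pos_def by (simp add: pos_def_operator_def linear_conv_bounded_linear)

lemma ip_commute: "ip x y = ip y x"
  using pos_def by (simp add: pos_def_operator_def)

lemma ip_pos: "x \<noteq> 0 \<Longrightarrow> ip x x > 0"
  using pos_def by (simp add: pos_def_operator_def)

sublocale B: bounded_linear B
  by (rule bounded_linear_B)

lemma ip_simps [simp]:
  "ip (x + y) z = ip x z + ip y z" "ip (x - y) z = ip x z - ip y z"
  "ip (- x) z = - ip x z" "ip (c *\<^sub>R x) z = c * ip x z" "ip 0 z = 0"
  "ip z (x + y) = ip z x + ip z y" "ip z (x - y) = ip z x - ip z y"
  "ip z (- x) = - ip z x" "ip z (c *\<^sub>R x) = c * ip z x" "ip z 0 = 0"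
  by (simp_all add: B.add B.diff B.neg B.scaleR B.zero blinfun.bilinear_simps)

lemma ip_nonneg: "ip x x \<ge> 0"
  using ip_pos[of x] by (cases "x = 0") auto

lemma pnorm_square: "(pn x)\<^sup>2 = ip x x"
  using ip_nonneg by (simp add: pnorm_def)

lemma pnorm_nonneg [simp]: "pn x \<ge> 0"
  using ip_nonneg by (simp add: pnorm_def)

lemma pnorm_eq_0_iff [simp]: "pn x = 0 \<longleftrightarrow> x = 0"
  using ip_pos[of x] by (cases "x = 0") (auto simp: pnorm_def)

lemma pnorm_zero [simp]: "pn 0 = 0"
  by simp

lemma pnorm_pos: "x \<noteq> 0 \<Longrightarrow> pn x > 0"
  using pnorm_nonneg[of x] pnorm_eq_0_iff[of x] by linarith

lemma pnorm_scaleR: "pn (c *\<^sub>R x) = \<bar>c\<bar> * pn x"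
  by (simp add: pnorm_def real_sqrt_mult real_sqrt_abs2 flip: mult.assoc)

lemma pnorm_minus [simp]: "pn (- x) = pn x"
  by (simp add: pnorm_def)

lemma pnorm_diff_commute: "pn (x - y) = pn (y - x)"
  by (metis minus_diff_eq pnorm_minus)

text \<open>Expanding the form at \<open>pn y\<close> times \<open>x\<close> minus
  \<open>pn x\<close> times \<open>y\<close> gives \<open>2 * pn x * pn y\<close> times the gap in
  the Cauchy-Schwarz inequality.\<close>

lemma ip_le_pnorm: "ip x y \<le> pn x * pn y"
proof (cases "x = 0 \<or> y = 0")
  case False
  then have x: "pn x > 0" and y: "pn y > 0"
    by (auto simp: pnorm_pos)
  have "0 \<le> ip (pn y *\<^sub>R x - pn x *\<^sub>R y) (pn y *\<^sub>R x - pn x *\<^sub>R y)"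
    by (rule ip_nonneg)
  also have "\<dots> = (pn y)\<^sup>2 * ip x x - 2 * pn x * pn y * ip x y + (pn x)\<^sup>2 * ip y y"
    by (simp add: ip_commute[of y x] algebra_simps power2_eq_square)
  also have "\<dots> = 2 * (pn x * pn y) * (pn x * pn y - ip x y)"
    unfolding pnorm_square[symmetric] by (simp add: algebra_simps power2_eq_square)
  finally show ?thesis
    using mult_pos_pos[OF x y] by (simp add: zero_le_mult_iff)
qed auto

lemma abs_ip_le_pnorm: "\<bar>ip x y\<bar> \<le> pn x * pn y"
  using ip_le_pnorm[of x y] ip_le_pnorm[of "- x" y] by simp

lemma pnorm_triangle: "pn (x + y) \<le> pn x + pn y"
proof (rule power2_le_imp_le)
  show "(pn (x + y))\<^sup>2 \<le> (pn x + pn y)\<^sup>2"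
    using ip_le_pnorm[of x y] by (simp add: pnorm_square power2_sum ip_commute[of y x])
qed simp

lemma pnorm_triangle_diff: "pn (x - y) \<le> pn x + pn y"
  using pnorm_triangle[of x "- y"] by simp

section \<open>Continuity, comparison with the Euclidean norm, compactness\<close>

lemma continuous_on_ip [continuous_intros]:
  assumes "continuous_on S f" "continuous_on S g"
  shows "continuous_on S (\<lambda>s. ip (f s) (g s))"
  by (intro continuous_intros assms B.continuous_on)

lemma continuous_on_pnorm [continuous_intros]:
  assumes "continuous_on S f"
  shows "continuous_on S (\<lambda>s. pn (f s))"
  unfolding pnorm_def by (intro continuous_intros assms)

text \<open>On the compact Euclidean unit sphere \<open>pn\<close> has a positive minimum; its
  reciprocal is the constant, by homogeneity. This makes the balls of \<open>pn\<close> bounded,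
  hence compact.\<close>

lemma norm_le_pnorm: obtains c where "c > 0" "\<And>x. norm x \<le> c * pn x"
proof -
  have "compact (sphere (0::'a) 1)" "sphere (0::'a) 1 \<noteq> {}"
    by auto
  moreover have "continuous_on (sphere (0::'a) 1) pn"
    by (intro continuous_intros)
  ultimately obtain z :: 'a where z: "norm z = 1" "\<And>y. norm y = 1 \<Longrightarrow> pn z \<le> pn y"
    using continuous_attains_inf[of "sphere (0::'a) 1" pn] by auto
  have zpos: "pn z > 0"
    using z(1) by (intro pnorm_pos) auto
  show thesis
  proof
    fix x :: 'a
    show "norm x \<le> 1 / pn z * pn x"
    proof (cases "x = 0")
      case False
      have "pn z \<le> pn ((1 / norm x) *\<^sub>R x)"
        using False by (intro z(2)) simp
      then show ?thesis
        using False zpos by (simp add: pnorm_scaleR field_simps)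
    qed auto
  qed (use zpos in simp)
qed

lemma compact_pnorm_cball: "compact {x. pn x \<le> r}"
proof -
  obtain c where c: "c > 0" "\<And>x. norm x \<le> c * pn x"
    using norm_le_pnorm by blast
  have "bounded {x. pn x \<le> r}"
  proof (rule boundedI)
    fix x assume "x \<in> {x. pn x \<le> r}"
    then have "c * pn x \<le> c * r"
      using c(1) by (intro mult_left_mono) auto
    then show "norm x \<le> c * r"
      using c(2)[of x] by linarith
  qed
  moreover have "closed {x. pn x \<le> r}"
    by (intro closed_Collect_le continuous_intros)
  ultimately show ?thesis
    by (simp add: compact_eq_bounded_closed)
qed

lemma compact_pnorm_sphere: "compact {x. pn x = 1}"
proof -
  have "{x. pn x = 1} = {x. pn x \<le> 1} \<inter> {x. pn x = 1}"
    by auto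
  moreover have "closed {x. pn x = 1}"
    by (intro closed_Collect_eq continuous_intros)
  ultimately show ?thesis
    using compact_Int_closed[OF compact_pnorm_cball] by metis
qed

lemma ex_pnorm_1: "\<exists>x. pn x = 1"
proof -
  obtain b :: 'a where "b \<in> Basis"
    using nonempty_Basis by blast
  then have "pn ((1 / pn b) *\<^sub>R b) = 1"
    using pnorm_pos[of b] by (auto simp: pnorm_scaleR)
  then show ?thesis ..
qed

section \<open>The isomorphism onto the dual and the dual norm\<close>

lemma inj_B: "inj B"
proof (rule injI)
  fix x y assume "B x = B y"
  then have "ip (x - y) (x - y) = 0"
    by simp
  then show "x = y"
    using ip_pos[of "x - y"] by force
qed

text \<open>In coordinates \<open>B\<close> becomes the endomorphism \<open>S\<close>, its Gram
  operator for the Euclidean inner product; an injective endomorphism of a finite-dimensional space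
  is onto. With injectivity this makes \<open>inv B\<close> in \<open>dnorm\<close> a genuine
  inverse.\<close>

lemma surj_B: "surj B"
proof -
  define S where "S = (\<lambda>x. \<Sum>b\<in>Basis. ip x b *\<^sub>R b)"
  have S: "S x \<bullet> y = ip x y" for x y
  proof -
    have "ip x y = ip x (\<Sum>b\<in>Basis. (y \<bullet> b) *\<^sub>R b)"
      by (simp add: euclidean_representation)
    also have "\<dots> = S x \<bullet> y"
      by (simp add: S_def blinfun.sum_right inner_sum_left inner_sum_right inner_commute mult.commute blinfun.scaleR_right)
    finally show ?thesis ..
  qed
  have "linear S"
    by (rule linearI) (simp_all add: S_def algebra_simps sum.distrib scaleR_sum_right)
  moreover have "inj S"
  proof (rule injI)
    fix x y assume "S x = S y"
    then have "ip x z = ip y z" for z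
      by (simp flip: S)
    then have "B x = B y"
      by (rule blinfun_eqI)
    then show "x = y"
      using inj_B by (simp add: inj_eq)
  qed
  ultimately have "surj S"
    by (rule linear_injective_imp_surjective) (rule refl)
  show ?thesis
  proof (rule surjI)
    fix g :: "'a \<Rightarrow>\<^sub>L real"
    define w where "w = (\<Sum>b\<in>Basis. blinfun_apply g b *\<^sub>R b)"
    have "blinfun_apply g y = w \<bullet> y" for y
    proof -
      have "blinfun_apply g y = blinfun_apply g (\<Sum>b\<in>Basis. (y \<bullet> b) *\<^sub>R b)"
        by (simp add: euclidean_representation)
      also have "\<dots> = w \<bullet> y"
        by (simp add: w_def blinfun.sum_right inner_sum_left inner_sum_right inner_commute mult.commute blinfun.scaleR_right)
      finally show ?thesis .
    qed
    moreover have "S (inv S w) = w"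
      using \<open>surj S\<close> by (rule surj_f_inv_f)
    ultimately show "B (inv S w) = g"
      by (intro blinfun_eqI) (simp flip: S)
  qed
qed

text \<open>Since \<open>inv B\<close> undoes \<open>B\<close>, \<open>dnorm\<close> is
  \<open>pn\<close> transported along a bijection and inherits its norm properties.\<close>

lemma dnorm_B: "dnorm B (B w) = pn w"
  by (simp add: dnorm_def pnorm_def inv_f_f[OF inj_B])

lemma obtain_B: obtains w where "g = B w"
  using surj_B by (metis surjD)

lemma dnorm_nonneg [simp]: "dnorm B g \<ge> 0"
  by (rule obtain_B[of g]) (simp add: dnorm_B)

lemma dnorm_eq_0_iff: "dnorm B g = 0 \<longleftrightarrow> g = 0"
  by (rule obtain_B[of g]) (metis B.zero dnorm_B inj_B injD pnorm_eq_0_iff)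

lemma dnorm_triangle: "dnorm B (f + g) \<le> dnorm B f + dnorm B g"
  by (rule obtain_B[of f], rule obtain_B[of g]) (simp add: dnorm_B pnorm_triangle flip: B.add)

lemma dnorm_scaleR: "dnorm B (c *\<^sub>R g) = \<bar>c\<bar> * dnorm B g"
  by (rule obtain_B[of g]) (simp add: dnorm_B pnorm_scaleR flip: B.scaleR)

lemma dnorm_diff: "dnorm B (f - g) \<le> dnorm B f + dnorm B g"
  using dnorm_triangle[of f "- g"] dnorm_scaleR[of "-1" g] by simp

lemma dnorm_sum: "dnorm B (\<Sum>i\<in>I. f i) \<le> (\<Sum>i\<in>I. dnorm B (f i))"
proof (induction I rule: infinite_finite_induct)
  case (insert i I)
  then show ?case
    using dnorm_triangle[of "f i" "sum f I"] by auto
qed (auto simp: dnorm_eq_0_iff[THEN iffD2])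

text \<open>For \<open>g = B w\<close> the test vector \<open>d = w\<close> gives
  \<open>(pn w)\<^sup>2 \<le> K * pn w\<close>, so a one-sided bound suffices.\<close>

lemma dnorm_leI:
  assumes "\<And>d. blinfun_apply g d \<le> K * pn d" "K \<ge> 0"
  shows "dnorm B g \<le> K"
proof -
  obtain w where w: "g = B w"
    by (rule obtain_B)
  have "pn w * pn w \<le> K * pn w"
    using assms(1)[of w] by (simp add: w flip: pnorm_square power2_eq_square)
  then have "pn w \<le> K"
    using assms(2) pnorm_nonneg[of w] by (cases "pn w = 0") (auto simp: mult_le_cancel_right)
  then show ?thesis
    by (simp add: w dnorm_B)
qed

text \<open>The exponent is at least two, so the power is differentiable at the origin although
  \<open>pn\<close> is not. Written without division by \<open>pn z\<close>, one formula covers both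
  cases.\<close>

lemma has_derivative_pnorm_power:
  assumes "n \<ge> 1"
  shows "((\<lambda>z. pn z ^ (n + 1)) has_derivative (\<lambda>d. real (n + 1) * pn z ^ (n - 1) * ip z d)) (at z)"
proof (cases "z = 0")
  case False
  have B': "(B has_derivative B) (at z)"
    by (rule B.has_derivative) (rule has_derivative_ident)
  have "((\<lambda>z. ip z z) has_derivative (\<lambda>d. 2 * ip z d)) (at z)"
    by (rule has_derivative_eq_rhs, rule blinfun.FDERIV[OF B' has_derivative_ident])
       (simp add: fun_eq_iff ip_commute[of _ z])
  then have "(pn has_derivative (\<lambda>d. ip z d / pn z)) (at z)"
    unfolding pnorm_def[abs_def]
    by (rule has_derivative_eq_rhs[OF has_derivative_real_sqrt, rotated])
       (use ip_pos[OF False] in \<open>auto simp: fun_eq_iff divide_simps\<close>)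
  then have "((\<lambda>z. pn z ^ (n + 1)) has_derivative
      (\<lambda>d. real (n + 1) * (ip z d / pn z) * pn z ^ (n + 1 - 1))) (at z)"
    by (rule has_derivative_power)
  also have "(\<lambda>d. real (n + 1) * (ip z d / pn z) * pn z ^ (n + 1 - 1)) =
      (\<lambda>d. real (n + 1) * pn z ^ (n - 1) * ip z d)"
    using assms False by (cases n) (auto simp: fun_eq_iff field_simps)
  finally show ?thesis .
next
  case True
  obtain c where c: "c > 0" "\<And>x. ip x x \<le> c * norm x ^ 2"
  proof -
    obtain K where K: "\<And>x. norm (B x) \<le> norm x * K" "K \<ge> 0"
      using B.nonneg_bounded by blast
    show thesis
    proof
      show "K + 1 > 0" using K(2) by simp
      fix x
      have "ip x x \<le> norm (B x) * norm x"
        using norm_blinfun[of "B x" x] by simp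
      also have "\<dots> \<le> (norm x * K) * norm x"
        by (intro mult_right_mono K) simp
      also have "\<dots> \<le> (K + 1) * norm x ^ 2"
        by (simp add: power2_eq_square algebra_simps)
      finally show "ip x x \<le> (K + 1) * norm x ^ 2" .
    qed
  qed
  have "((\<lambda>z. pn z ^ (n + 1)) has_derivative (\<lambda>d. 0)) (at 0)"
  proof (rule has_derivative_at2[THEN iffD2], intro conjI)
    \<comment> \<open>Majorant of the difference quotient at the origin: two factors
      \<open>pn y\<close> are estimated by \<open>c * norm y ^ 2\<close>, and one factor
      \<open>norm y\<close> is divided out.\<close>
    have "(\<lambda>y. pn y ^ (n - 1) * (c * norm y)) \<midarrow>0\<rightarrow> pn (0::'a) ^ (n - 1) * (c * norm (0::'a))"
      by (intro tendsto_intros continuous_on_tendsto_compose[of UNIV pn])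
         (auto intro!: continuous_intros)
    then have lim: "(\<lambda>y. pn y ^ (n - 1) * (c * norm y)) \<midarrow>0\<rightarrow> 0"
      by simp
    show "(\<lambda>y. (1 / norm (y - 0)) *\<^sub>R (pn y ^ (n + 1) - (pn 0 ^ (n + 1) + 0))) \<midarrow>0\<rightarrow> 0"
    proof (rule Lim_null_comparison[OF _ lim], rule always_eventually, rule allI)
      fix y :: 'a
      have "pn y ^ (n + 1) = pn y ^ (n - 1) * ip y y"
        using assms by (cases n) (auto simp: power2_eq_square simp flip: pnorm_square)
      also have "\<dots> \<le> pn y ^ (n - 1) * (c * norm y ^ 2)"
        by (intro mult_left_mono c) simp
      finally have "pn y ^ (n + 1) \<le> pn y ^ (n - 1) * (c * norm y ^ 2)" .
      then show "norm ((1 / norm (y - 0)) *\<^sub>R (pn y ^ (n + 1) - (pn 0 ^ (n + 1) + 0)))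
          \<le> pn y ^ (n - 1) * (c * norm y)"
        by (cases "y = 0") (simp_all add: field_simps power2_eq_square)
    qed
  qed simp
  then show ?thesis
    using True by simp
qed

end

subsection \<open>Symmetric multilinear forms\<close>

text \<open>Arguments form a list to match \<open>nderiv\<close>. Symmetry is invariance under
  equality of multisets, so linearity need be demanded only in the head.\<close>

definition sym_multilinear :: "nat \<Rightarrow> ('a::real_vector list \<Rightarrow> real) \<Rightarrow> bool" where
  "sym_multilinear n A \<longleftrightarrow>
     (\<forall>xs ys. length xs = n \<longrightarrow> mset xs = mset ys \<longrightarrow> A xs = A ys) \<and>
     (\<forall>ds. Suc (length ds) = n \<longrightarrow> linear (\<lambda>d. A (d # ds)))"

lemma sym_multilinear_mset:
  "sym_multilinear n A \<Longrightarrow> mset xs = mset ys \<Longrightarrow> length xs = n \<Longrightarrow> A xs = A ys"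
  by (auto simp: sym_multilinear_def)

lemma sym_multilinear_linear:
  "sym_multilinear n A \<Longrightarrow> Suc (length ds) = n \<Longrightarrow> linear (\<lambda>d. A (d # ds))"
  by (auto simp: sym_multilinear_def)

lemma sym_multilinear_diff:
  assumes "sym_multilinear n A" "sym_multilinear n A'"
  shows "sym_multilinear n (\<lambda>ds. A ds - A' ds)"
  unfolding sym_multilinear_def
proof (intro conjI allI impI)
  fix xs ys :: "'a list" assume "length xs = n" "mset xs = mset ys"
  then show "A xs - A' xs = A ys - A' ys"
    using assms sym_multilinear_mset by metis
next
  fix ds :: "'a list" assume "Suc (length ds) = n"
  then show "linear (\<lambda>d. A (d # ds) - A' (d # ds))"
    using assms by (intro linear_compose_sub sym_multilinear_linear)
qed

lemma sym_multilinear_Cons_basis: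
  fixes A :: "'a::euclidean_space list \<Rightarrow> real"
  assumes "sym_multilinear n A" "Suc (length ds) = n"
  shows "A (z # ds) = (\<Sum>b\<in>Basis. (z \<bullet> b) * A (b # ds))"
proof -
  have lin: "linear (\<lambda>d. A (d # ds))"
    by (rule sym_multilinear_linear[OF assms])
  have "A (z # ds) = A ((\<Sum>b\<in>Basis. (z \<bullet> b) *\<^sub>R b) # ds)"
    by (simp add: euclidean_representation)
  also have "\<dots> = (\<Sum>b\<in>Basis. (z \<bullet> b) * A (b # ds))"
    by (simp add: linear_sum[OF lin] linear_cmul[OF lin])
  finally show ?thesis .
qed

text \<open>Linearity is at hand only for the head: an entry is rescaled there and then moved by
  symmetry into \<open>es\<close>, which collects the entries already treated.\<close>

lemma sym_multilinear_append_scaleR: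
  assumes "sym_multilinear n A" "length ds + length es = n"
  shows "A (map (\<lambda>d. c d *\<^sub>R s d) ds @ es) = prod_list (map c ds) * A (map s ds @ es)"
  using assms(2)
proof (induction ds arbitrary: es)
  case (Cons d ds)
  let ?m = "\<lambda>d. c d *\<^sub>R s d"
  have "A (map ?m (d # ds) @ es) = c d * A (s d # map ?m ds @ es)"
    using linear_cmul[OF sym_multilinear_linear[OF assms(1), of "map ?m ds @ es"]] Cons.prems by simp
  also have "A (s d # map ?m ds @ es) = A (map ?m ds @ s d # es)"
    using Cons.prems by (intro sym_multilinear_mset[OF assms(1)]) auto
  also have "\<dots> = prod_list (map c ds) * A (map s ds @ s d # es)"
    using Cons.prems by (intro Cons.IH) auto
  also have "A (map s ds @ s d # es) = A (map s (d # ds) @ es)"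
    using Cons.prems by (intro sym_multilinear_mset[OF assms(1)]) auto
  finally show ?case by simp
qed simp

text \<open>Each induction step expands one argument in the basis, leaving continuous coordinates
  times forms with fewer varying arguments; the basis vectors accumulate in
  \<open>es\<close>.\<close>

lemma continuous_on_sym_multilinear:
  fixes A :: "'a::euclidean_space list \<Rightarrow> real" and f :: "'b::topological_space \<Rightarrow> nat \<Rightarrow> 'a"
  assumes A: "sym_multilinear n A" and f: "\<And>i. continuous_on S (\<lambda>x. f x i)"
  shows "k + length es = n \<Longrightarrow> continuous_on S (\<lambda>x. A (map (f x) [0..<k] @ es))"
proof (induction k arbitrary: es)
  case (Suc k)
  have "A (map (f x) [0..<Suc k] @ es) = (\<Sum>b\<in>Basis. (f x k \<bullet> b) * A (map (f x) [0..<k] @ b # es))" for x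
  proof -
    have "A (map (f x) [0..<Suc k] @ es) = A (f x k # map (f x) [0..<k] @ es)"
      using Suc.prems by (intro sym_multilinear_mset[OF A]) auto
    also have "\<dots> = (\<Sum>b\<in>Basis. (f x k \<bullet> b) * A (b # map (f x) [0..<k] @ es))"
      using Suc.prems by (intro sym_multilinear_Cons_basis[OF A]) auto
    also have "\<dots> = (\<Sum>b\<in>Basis. (f x k \<bullet> b) * A (map (f x) [0..<k] @ b # es))"
      using Suc.prems by (intro sum.cong refl arg_cong2[where f = "(*)"] sym_multilinear_mset[OF A]) auto
    finally show ?thesis .
  qed
  then show ?case
    using Suc.prems by (auto intro!: continuous_intros f Suc.IH simp del: upt_Suc)
qed simp

text \<open>One copy of \<open>z\<close> is expanded in the basis; the product rule and the
  induction hypothesis treat the others.\<close>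

lemma has_derivative_sym_multilinear_append:
  fixes A :: "'a::euclidean_space list \<Rightarrow> real"
  assumes A: "sym_multilinear n A"
  shows "k + length es = n \<Longrightarrow> ((\<lambda>z. A (replicate k z @ es)) has_derivative
    (\<lambda>d. real k * A (d # replicate (k - 1) z @ es))) (at z)"
proof (induction k arbitrary: es)
  case (Suc k)
  have len: "k + length (b # es) = n" for b
    using Suc.prems by simp
  have move: "A (w # replicate j z @ es) = A (replicate j z @ w # es)"
    if "Suc (j + length es) = n" for w z j
    using that by (intro sym_multilinear_mset[OF A]) auto
  have basis: "A (w # replicate k z @ es) = (\<Sum>b\<in>Basis. (w \<bullet> b) * A (replicate k z @ b # es))" for z w
  proof -
    have "A (w # replicate k z @ es) = (\<Sum>b\<in>Basis. (w \<bullet> b) * A (b # replicate k z @ es))"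
      using Suc.prems by (intro sym_multilinear_Cons_basis[OF A]) auto
    then show ?thesis
      using Suc.prems by (simp add: move)
  qed
  have der: "((\<lambda>z. \<Sum>b\<in>Basis. (z \<bullet> b) * A (replicate k z @ b # es)) has_derivative
      (\<lambda>d. \<Sum>b\<in>Basis. (z \<bullet> b) * (real k * A (d # replicate (k - 1) z @ b # es))
        + (d \<bullet> b) * A (replicate k z @ b # es))) (at z)"
    by (intro has_derivative_sum has_derivative_mult Suc.IH len
        bounded_linear_imp_has_derivative bounded_linear_inner_left)
  \<comment> \<open>Summing over the basis puts \<open>z\<close> back into its slot. By symmetry the
    \<open>k\<close> terms from the induction hypothesis and the one from the expanded slot
    coincide, hence the factor \<open>Suc k\<close>.\<close>
  have rhs: "(\<Sum>b\<in>Basis. (z \<bullet> b) * (real k * A (d # replicate (k - 1) z @ b # es))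
        + (d \<bullet> b) * A (replicate k z @ b # es)) = real (Suc k) * A (d # replicate (Suc k - 1) z @ es)"
    for d
  proof (cases k)
    case 0
    then show ?thesis
      using basis[of d z] by simp
  next
    case (Suc j)
    have "(\<Sum>b\<in>Basis. (z \<bullet> b) * A (d # replicate j z @ b # es))
        = (\<Sum>b\<in>Basis. (z \<bullet> b) * A (b # d # replicate j z @ es))"
      using len Suc by (intro sum.cong refl arg_cong2[where f = "(*)"] sym_multilinear_mset[OF A]) auto
    also have "\<dots> = A (z # d # replicate j z @ es)"
      using len Suc by (intro sym_multilinear_Cons_basis[OF A, symmetric]) auto
    also have "\<dots> = A (d # replicate k z @ es)"
      using len Suc by (intro sym_multilinear_mset[OF A]) auto
    finally have "(\<Sum>b\<in>Basis. (z \<bullet> b) * A (d # replicate j z @ b # es)) = A (d # replicate k z @ es)" .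
    moreover have "(\<Sum>b\<in>Basis. (z \<bullet> b) * (real k * A (d # replicate (k - 1) z @ b # es)))
        = real k * (\<Sum>b\<in>Basis. (z \<bullet> b) * A (d # replicate j z @ b # es))"
      by (simp add: Suc sum_distrib_left mult_ac)
    ultimately show ?thesis
      using basis[of d z] by (simp add: sum.distrib algebra_simps)
  qed
  have rep: "A (replicate (Suc k) w @ es) = (\<Sum>b\<in>Basis. (w \<bullet> b) * A (replicate k w @ b # es))" for w
    using basis[of w w] by simp
  show ?case
    unfolding rep by (rule has_derivative_eq_rhs[OF der]) (rule ext, rule rhs)
qed simp

lemma has_derivative_sym_multilinear:
  fixes A :: "'a::euclidean_space list \<Rightarrow> real"
  assumes "sym_multilinear n A"
  shows "((\<lambda>z. A (replicate n z)) has_derivative (\<lambda>d. real n * A (d # replicate (n - 1) z))) (at z)"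
  using has_derivative_sym_multilinear_append[OF assms, of n "[]" z] by simp

section \<open>Banach's theorem on symmetric multilinear forms\<close>

context pos_def
begin

text \<open>Both vectors may be replaced by their normalised sum at a maximum of a symmetric bilinear form:
  by polarisation \<open>4 P(a, b) = P(a + b, a + b) - P(a - b, a - b)\<close>, while the squared norms of
  \<open>a + b\<close> and \<open>a - b\<close> add up to \<open>4\<close>.\<close>

lemma bilinear_max_at_sum:
  fixes P :: "'a \<Rightarrow> 'a \<Rightarrow> real"
  assumes lin: "\<And>y. linear (\<lambda>x. P x y)" and sym: "\<And>x y. P x y = P y x"
    and le: "\<And>x. pn x = 1 \<Longrightarrow> \<bar>P x x\<bar> \<le> l"
    and ab: "pn a = 1" "pn b = 1" "\<bar>P a b\<bar> = l"
  shows "l * (pn (a + b))\<^sup>2 \<le> \<bar>P (a + b) (a + b)\<bar>"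
proof -
  have add: "P (x + y) z = P x z + P y z" for x y z
    using linear_add[OF lin] .
  have diff: "P (x - y) z = P x z - P y z" for x y z
    using linear_diff[OF lin] .
  have scale: "P (c *\<^sub>R x) z = c * P x z" for c x z
    using linear_cmul[OF lin] by simp
  have add': "P z (x + y) = P z x + P z y" and diff': "P z (x - y) = P z x - P z y"
    and scale': "P z (c *\<^sub>R x) = c * P z x" for c x y z
    using add diff scale by (simp_all add: sym[of z])
  have quad: "\<bar>P x x\<bar> \<le> l * (pn x)\<^sup>2" for x
  proof (cases "x = 0")
    case True
    then show ?thesis
      using linear_0[OF lin] by simp
  next
    case False
    then have "\<bar>P ((1 / pn x) *\<^sub>R x) ((1 / pn x) *\<^sub>R x)\<bar> \<le> l"
      by (intro le) (simp add: pnorm_scaleR)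
    then show ?thesis
      using pnorm_pos[OF False] by (simp add: scale scale' abs_mult field_simps power2_eq_square)
  qed
  have "4 * P a b = P (a + b) (a + b) - P (a - b) (a - b)"
    by (simp add: add diff add' diff' sym[of b a])
  then have "4 * l \<le> \<bar>P (a + b) (a + b)\<bar> + \<bar>P (a - b) (a - b)\<bar>"
    using ab(3) by linarith
  also have "\<dots> \<le> \<bar>P (a + b) (a + b)\<bar> + l * (pn (a - b))\<^sup>2"
    using quad[of "a - b"] by simp
  finally have "l * (4 - (pn (a - b))\<^sup>2) \<le> \<bar>P (a + b) (a + b)\<bar>"
    by (simp add: algebra_simps)
  moreover have "(pn (a + b))\<^sup>2 = 4 - (pn (a - b))\<^sup>2"
    using ab(1,2) pnorm_square[of a] pnorm_square[of b] by (simp add: pnorm_square ip_commute[of b a])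
  ultimately show ?thesis
    by simp
qed

text \<open>The geometric core of Banach's theorem. In the application \<open>R\<close> is the sum of the remaining
  arguments of the form, and the two inequalities come from flipping the sign of one argument.\<close>

lemma pnorm_normalised_sum_greater:
  assumes ab: "pn a = 1" "pn b = 1" "a \<noteq> b"
    and flip: "ip a (b + R) \<ge> 0" "ip b (a + R) \<ge> 0"
  shows "a + b \<noteq> 0"
    and "(pn (a + b + R))\<^sup>2 < (pn ((2 / pn (a + b)) *\<^sub>R (a + b) + R))\<^sup>2"
proof -
  define t where "t = ip a b"
  have aa: "ip a a = 1" and bb: "ip b b = 1" and ba: "ip b a = t"
    using ab pnorm_square[of a] pnorm_square[of b] by (simp_all add: t_def ip_commute)
  have fl: "t + ip a R \<ge> 0" "t + ip b R \<ge> 0"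
    using flip ba by (simp_all add: t_def)
  show s: "a + b \<noteq> 0"
  proof
    assume "a + b = 0"
    then have b: "b = - a"
      by (simp add: eq_neg_iff_add_eq_0 add.commute)
    then show False
      using fl aa by (simp add: t_def)
  qed
  have t: "t < 1"
    using ip_pos[of "a - b"] ab(3) by (simp add: aa bb ba flip: t_def)
  have ss: "(pn (a + b))\<^sup>2 = 2 + 2 * t"
    by (simp add: pnorm_square aa bb ba flip: t_def)
  define c where "c = 2 / pn (a + b)"
  have "(pn (a + b))\<^sup>2 < 2\<^sup>2"
    using t by (simp add: ss)
  then have "pn (a + b) < 2"
    by (rule power2_less_imp_less) simp
  then have c: "c > 1"
    using pnorm_pos[OF s] by (simp add: c_def)
  \<comment> \<open>The second factor is at least \<open>4\<close>: \<open>c + 1 > 2\<close> and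
    \<open>1 + t > 0\<close>, while the flip inequalities bound \<open>ip a R + ip b R\<close> below
    by \<open>- 2 * t\<close>.\<close>
  have "(pn (c *\<^sub>R (a + b) + R))\<^sup>2 - (pn (a + b + R))\<^sup>2
      = (c - 1) * ((c + 1) * (2 + 2 * t) + 2 * (ip a R + ip b R))"
    by (simp add: pnorm_square aa bb ba ip_commute[of R a] ip_commute[of R b] algebra_simps flip: t_def)
  also have "\<dots> > 0"
  proof (intro mult_pos_pos)
    have "(1 + t) > 0"
      using ss pnorm_pos[OF s] by (smt (verit) zero_less_power2)
    then have "2 * (2 + 2 * t) \<le> (c + 1) * (2 + 2 * t)"
      using c by (intro mult_right_mono) auto
    then show "0 < (c + 1) * (2 + 2 * t) + 2 * (ip a R + ip b R)"
      using fl by (simp add: algebra_simps)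
  qed (use c in simp)
  finally show "(pn (a + b + R))\<^sup>2 < (pn ((2 / pn (a + b)) *\<^sub>R (a + b) + R))\<^sup>2"
    by (simp add: c_def)
qed

text \<open>Tychonoff's theorem for a product of compact unit spheres. Tuples are encoded as
  sequences, of which a form reads the first \<open>n\<close> entries.\<close>

lemma compact_sphere_functions: "compact {f :: nat \<Rightarrow> 'a. \<forall>i. pn (f i) = 1}"
proof -
  have "compactin (product_topology (\<lambda>i. euclidean) UNIV) (PiE (UNIV :: nat set) (\<lambda>i. {x. pn x = 1}))"
    by (simp add: compactin_PiE compact_pnorm_sphere)
  moreover have "PiE (UNIV :: nat set) (\<lambda>i. {x. pn x = 1}) = {f. \<forall>i. pn (f i) = 1}"
    by (auto simp: PiE_iff)
  ultimately show ?thesis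
    by (simp add: euclidean_product_topology)
qed

text \<open>Banach's theorem. Among the tuples of unit vectors that maximise \<open>\<bar>A\<bar>\<close>, one whose sum has
  maximal norm is constant: otherwise two distinct entries could be replaced by their normalised
  sum, which preserves maximality and lengthens the sum.\<close>

lemma sym_multilinear_unit_bound:
  fixes f :: "nat \<Rightarrow> 'a"
  assumes A: "sym_multilinear n A"
    and K: "\<And>d. pn d = 1 \<Longrightarrow> \<bar>A (replicate n d)\<bar> \<le> K"
    and f: "\<And>i. pn (f i) = 1"
  shows "\<bar>A (map f [0..<n])\<bar> \<le> K"
proof -
  define S where "S = {f :: nat \<Rightarrow> 'a. \<forall>i. pn (f i) = 1}"
  define G where "G = (\<lambda>f :: nat \<Rightarrow> 'a. \<bar>A (map f [0..<n])\<bar>)"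
  have S: "compact S" "f \<in> S"
    using compact_sphere_functions f by (simp_all add: S_def)
  have G: "continuous_on UNIV G"
    unfolding G_def
    using continuous_on_sym_multilinear[OF A, of UNIV "\<lambda>f. f" n "[]"]
    by (auto intro!: continuous_intros continuous_on_product_coordinates)
  obtain f0 where f0: "f0 \<in> S" "\<And>f. f \<in> S \<Longrightarrow> G f \<le> G f0"
    using continuous_attains_sup[of S G] S G continuous_on_subset by blast
  define l where "l = G f0"
  define S' where "S' = S \<inter> {f. G f = l}"
  have "closed {f. G f = l}"
    by (intro closed_Collect_eq G continuous_intros)
  then have "compact S'"
    unfolding S'_def using S by (intro compact_Int_closed)
  moreover have "f0 \<in> S'"
    using f0 by (simp add: S'_def l_def)
  moreover have "continuous_on S' (\<lambda>f. (pn (\<Sum>i<n. f i))\<^sup>2)"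
    by (intro continuous_intros continuous_on_subset[OF continuous_on_product_coordinates]) auto
  ultimately obtain g where g: "g \<in> S'"
    and gmax: "\<And>f. f \<in> S' \<Longrightarrow> (pn (\<Sum>i<n. f i))\<^sup>2 \<le> (pn (\<Sum>i<n. g i))\<^sup>2"
    using continuous_attains_sup[of S' "\<lambda>f. (pn (\<Sum>i<n. f i))\<^sup>2"] by blast
  have g1: "pn (g i) = 1" for i
    using g by (auto simp: S'_def S_def)
  have eq: "g i = g j" if ij: "i < n" "j < n" "i \<noteq> j" for i j
  proof (rule ccontr)
    assume neq: "g i \<noteq> g j"
    define I where "I = {..<n} - {i, j}"
    define ks where "ks = sorted_list_of_set I"
    define R where "R = sum g I"
    \<comment> \<open>The form in the slots \<open>i\<close> and \<open>j\<close> with the other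
      entries frozen; \<open>upd\<close> makes the matching change in the sequence.\<close>
    define P where "P = (\<lambda>x y. A (x # y # map g ks))"
    have fin: "finite I"
      by (simp add: I_def)
    have ins: "{..<n} = insert i (insert j I)" and notin: "i \<notin> insert j I" "j \<notin> I"
      using ij by (auto simp: I_def)
    have "mset ks = mset_set I"
      using fin mset_set_set[of ks] by (simp add: ks_def)
    then have mset: "mset [0..<n] = add_mset i (add_mset j (mset ks))"
      using fin notin by (simp add: ins lessThan_atLeast0[symmetric])
    have len: "Suc (Suc (length ks)) = n"
      using arg_cong[OF mset, of size] by simp
    define upd where "upd = (\<lambda>x y. g(i := x, j := y))"
    have map_upd: "map (upd x y) ks = map g ks" for x y
      using notin fin by (auto simp: upd_def ks_def)
    have A_upd: "A (map (upd x y) [0..<n]) = P x y" for x y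
    proof -
      have "A (map (upd x y) [0..<n]) = A (upd x y i # upd x y j # map (upd x y) ks)"
        by (intro sym_multilinear_mset[OF A]) (simp_all add: mset del: mset_upt)
      then show ?thesis
        using ij by (simp add: map_upd P_def) (simp add: upd_def)
    qed
    have sum_upd: "(\<Sum>k<n. upd x y k) = x + y + R" for x y
    proof -
      have "sum (upd x y) I = R"
        unfolding R_def using notin by (intro sum.cong) (auto simp: upd_def)
      then show ?thesis
        using fin notin ij by (simp add: ins) (simp add: upd_def add.assoc)
    qed
    have S_upd: "upd x y \<in> S" if "pn x = 1" "pn y = 1" for x y
      using that g1 by (simp add: S_def upd_def)
    have upd_g: "upd (g i) (g j) = g"
      by (simp add: upd_def)
    have P_le: "\<bar>P x y\<bar> \<le> l" if "pn x = 1" "pn y = 1" for x y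
      using f0(2)[OF S_upd[OF that]] by (simp add: G_def A_upd l_def)
    have P_g: "\<bar>P (g i) (g j)\<bar> = l"
      using g A_upd[of "g i" "g j"] by (simp add: S'_def G_def upd_g)
    have max: "(pn (x + y + R))\<^sup>2 \<le> (pn (g i + g j + R))\<^sup>2"
      if "pn x = 1" "pn y = 1" "\<bar>P x y\<bar> = l" for x y
      using gmax[of "upd x y"] S_upd[of x y] that sum_upd[of x y] sum_upd[of "g i" "g j"]
      by (simp add: S'_def G_def A_upd upd_g)
    have sym: "P x y = P y x" for x y
      unfolding P_def using len by (intro sym_multilinear_mset[OF A]) auto
    have lin: "linear (\<lambda>x. P x y)" for y
      unfolding P_def using len by (intro sym_multilinear_linear[OF A]) auto
    have neg: "P (- x) y = - P x y" and scale: "P (c *\<^sub>R x) y = c * P x y" for c x y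
      using linear_neg[OF lin] linear_cmul[OF lin] by auto
    define s where "s = g i + g j"
    \<comment> \<open>Changing the sign of one entry leaves \<bar>\<open>P\<close>\<bar> unchanged,
      so the tuple remains a maximiser; that its sum is not longer is the required sign
      condition.\<close>
    have "(pn (- g i + g j + R))\<^sup>2 \<le> (pn (g i + g j + R))\<^sup>2"
      by (rule max) (simp_all add: g1 neg P_g)
    then have flip1: "0 \<le> ip (g i) (g j + R)"
      by (simp add: pnorm_square ip_commute[of R "g i"] ip_commute[of "g j" "g i"])
    have "(pn (g i + - g j + R))\<^sup>2 \<le> (pn (g i + g j + R))\<^sup>2"
      by (rule max) (simp_all add: g1 neg sym[of "g i"] P_g[unfolded sym[of "g i"]])
    then have flip2: "0 \<le> ip (g j) (g i + R)"
      by (simp add: pnorm_square ip_commute[of R "g j"] ip_commute[of "g j" "g i"])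
    have s: "s \<noteq> 0" and less: "(pn (s + R))\<^sup>2 < (pn ((2 / pn s) *\<^sub>R s + R))\<^sup>2"
      using pnorm_normalised_sum_greater[OF g1 g1 neq flip1 flip2] by (simp_all add: s_def)
    define e where "e = (1 / pn s) *\<^sub>R s"
    have e1: "pn e = 1"
      using s by (simp add: e_def pnorm_scaleR)
    have ls: "l * (pn s)\<^sup>2 \<le> \<bar>P s s\<bar>"
      unfolding s_def by (intro bilinear_max_at_sum lin sym P_le P_g g1)
    have "P e e = P s s / (pn s)\<^sup>2"
      by (simp add: e_def scale sym[of s "(1 / pn s) *\<^sub>R s"] power2_eq_square)
    then have "l \<le> \<bar>P e e\<bar>"
      using ls s by (simp add: pos_le_divide_eq)
    then have "\<bar>P e e\<bar> = l"
      using P_le[OF e1 e1] by simp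
    then have "(pn (e + e + R))\<^sup>2 \<le> (pn (s + R))\<^sup>2"
      using max[OF e1 e1] by (simp add: s_def)
    moreover have "e + e = (2 / pn s) *\<^sub>R s"
      by (simp add: e_def flip: scaleR_add_left)
    ultimately show False
      using less by (metis not_less)
  qed
  have const: "g k = g 0" if "k < n" for k
    using eq[of k 0] that by (cases "k = 0") auto
  have "map g [0..<n] = replicate n (g 0)"
  proof (rule nth_equalityI)
    fix k assume "k < length (map g [0..<n])"
    then have "k < n" by simp
    then show "map g [0..<n] ! k = replicate n (g 0) ! k"
      by (simp add: const[of k])
  qed simp
  then have "A (map g [0..<n]) = A (replicate n (g 0))"
    by (rule arg_cong)
  then have "l \<le> K"
    using g K[OF g1[of 0]] by (simp add: S'_def G_def)
  moreover have "\<bar>A (map f [0..<n])\<bar> \<le> l"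
    using f0(2)[OF S(2)] by (simp add: G_def l_def)
  ultimately show ?thesis by simp
qed

text \<open>Homogeneity in every slot reduces the claim to unit vectors.\<close>

lemma sym_multilinear_bound:
  fixes ds :: "'a list"
  assumes A: "sym_multilinear n A"
    and K: "\<And>d. pn d = 1 \<Longrightarrow> \<bar>A (replicate n d)\<bar> \<le> K"
    and len: "length ds = n"
  shows "\<bar>A ds\<bar> \<le> K * prod_list (map pn ds)"
proof -
  obtain e where e: "pn e = 1"
    using ex_pnorm_1 by blast
  \<comment> \<open>A zero entry receives the unit vector \<open>e\<close> as its direction, so
    \<open>d\<close> equals \<open>pn d\<close> times \<open>s d\<close> without exception.\<close>
  define s where "s = (\<lambda>d. if d = 0 then e else (1 / pn d) *\<^sub>R d)"
  have s1: "pn (s d) = 1" for d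
    using e by (simp add: s_def pnorm_scaleR)
  have s: "pn d *\<^sub>R s d = d" for d
    by (simp add: s_def)
  have "A ds = prod_list (map pn ds) * A (map s ds)"
    using sym_multilinear_append_scaleR[OF A, of ds "[]" pn s] len by (simp add: s)
  moreover have "\<bar>A (map s ds)\<bar> \<le> K"
  proof -
    have "map s ds = map (\<lambda>i. s (ds ! i)) [0..<n]"
      using len by (intro nth_equalityI) auto
    then show ?thesis
      using sym_multilinear_unit_bound[OF A K, of "\<lambda>i. s (ds ! i)"] s1 by simp
  qed
  moreover have "prod_list (map pn ds) \<ge> 0"
    by (induction ds) auto
  ultimately show ?thesis
    by (simp add: abs_mult mult.commute mult_right_mono)
qed

end

subsection \<open>Higher derivatives as symmetric multilinear forms\<close>

lemma cont_diff_differentiable: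
  "cont_diff n f \<Longrightarrow> length ds < n \<Longrightarrow> nderiv f ds differentiable (at x)"
  by (simp add: cont_diff_def)

lemma cont_diff_continuous: "cont_diff n f \<Longrightarrow> length ds \<le> n \<Longrightarrow> continuous_on UNIV (nderiv f ds)"
  by (simp add: cont_diff_def)

lemma cont_diff_has_derivative:
  assumes "cont_diff n f" "length ds < n"
  shows "(nderiv f ds has_derivative (\<lambda>d. nderiv f (d # ds) x)) (at x)"
  using cont_diff_differentiable[OF assms] by (simp add: frechet_derivative_works)

section \<open>Symmetry of mixed derivatives\<close>

lemma has_field_derivative_along_line:
  fixes g :: "'a::real_normed_vector \<Rightarrow> real"
  assumes "(g has_derivative g') (at (x + t *\<^sub>R v))"
  shows "((\<lambda>s. g (x + s *\<^sub>R v)) has_real_derivative g' v) (at t)"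
proof -
  have "((\<lambda>s. x + s *\<^sub>R v) has_derivative (\<lambda>s. s *\<^sub>R v)) (at t)"
    by (auto intro!: derivative_eq_intros)
  from has_derivative_compose[OF this assms]
  have "((\<lambda>s. g (x + s *\<^sub>R v)) has_derivative (\<lambda>s. g' (s *\<^sub>R v))) (at t)" .
  moreover have "(\<lambda>s. g' (s *\<^sub>R v)) = (*) (g' v)"
    using linear_cmul[OF has_derivative_linear[OF assms]] by (simp add: fun_eq_iff)
  ultimately show ?thesis
    by (simp add: has_field_derivative_def)
qed

text \<open>The mean value theorem is used twice: along \<open>b\<close> for the difference of
  \<open>g\<close> on two parallel segments, then along \<open>a\<close> for the derivative. The
  second difference is symmetric in \<open>a\<close> and \<open>b\<close>, which is the source of
  Schwarz's theorem.\<close>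

lemma second_difference_mvt:
  fixes g :: "'a::real_normed_vector \<Rightarrow> real"
  assumes g: "\<And>x. (g has_derivative (\<lambda>d. Dg d x)) (at x)"
    and Db: "\<And>x. (Dg b has_derivative (\<lambda>d. DDg d x)) (at x)"
    and s: "s > 0"
  obtains \<sigma> \<tau> where "0 < \<sigma>" "\<sigma> < s" "0 < \<tau>" "\<tau> < s"
    "g (x + s *\<^sub>R a + s *\<^sub>R b) - g (x + s *\<^sub>R a) - g (x + s *\<^sub>R b) + g x
      = s\<^sup>2 * DDg a (x + \<sigma> *\<^sub>R a + \<tau> *\<^sub>R b)"
proof -
  define \<phi> where "\<phi> = (\<lambda>t. g ((x + s *\<^sub>R a) + t *\<^sub>R b) - g (x + t *\<^sub>R b))"
  have "\<exists>\<tau>>0. \<tau> < s \<and> \<phi> s - \<phi> 0 = (s - 0) * (Dg b ((x + s *\<^sub>R a) + \<tau> *\<^sub>R b) - Dg b (x + \<tau> *\<^sub>R b))"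
    unfolding \<phi>_def
    by (intro MVT2 s DERIV_diff has_field_derivative_along_line g)
  then obtain \<tau> where \<tau>: "0 < \<tau>" "\<tau> < s"
    "\<phi> s - \<phi> 0 = s * (Dg b ((x + s *\<^sub>R a) + \<tau> *\<^sub>R b) - Dg b (x + \<tau> *\<^sub>R b))"
    by auto
  define \<psi> where "\<psi> = (\<lambda>t. Dg b ((x + \<tau> *\<^sub>R b) + t *\<^sub>R a))"
  have "\<exists>\<sigma>>0. \<sigma> < s \<and> \<psi> s - \<psi> 0 = (s - 0) * DDg a ((x + \<tau> *\<^sub>R b) + \<sigma> *\<^sub>R a)"
    unfolding \<psi>_def
    by (intro MVT2 s has_field_derivative_along_line Db)
  then obtain \<sigma> where \<sigma>: "0 < \<sigma>" "\<sigma> < s" "\<psi> s - \<psi> 0 = s * DDg a ((x + \<tau> *\<^sub>R b) + \<sigma> *\<^sub>R a)"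
    by auto
  show thesis
    by (rule that[OF \<sigma>(1,2) \<tau>(1,2)])
       (use \<tau>(3) \<sigma>(3) in \<open>simp add: \<phi>_def \<psi>_def power2_eq_square algebra_simps\<close>)
qed

text \<open>Evaluating the second difference in both orders shows that \<open>DDg a b\<close> and
  \<open>DDg b a\<close> agree at two points whose distance from \<open>x\<close> is of order
  \<open>s\<close>; continuity at \<open>x\<close> finishes as \<open>s\<close> shrinks.\<close>

lemma mixed_derivatives_eq:
  fixes g :: "'a::real_normed_vector \<Rightarrow> real"
  assumes g: "\<And>x. (g has_derivative (\<lambda>d. Dg d x)) (at x)"
    and D: "\<And>c x. (Dg c has_derivative (\<lambda>d. DDg d c x)) (at x)"
    and cont: "continuous (at x) (DDg a b)" "continuous (at x) (DDg b a)"
  shows "DDg a b x = DDg b a x"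
proof -
  have ex: "\<exists>y z. norm (y - x) \<le> s * (norm a + norm b) \<and> norm (z - x) \<le> s * (norm a + norm b)
      \<and> DDg a b y = DDg b a z" if s: "s > 0" for s
  proof -
    obtain \<sigma> \<tau> where st: "0 < \<sigma>" "\<sigma> < s" "0 < \<tau>" "\<tau> < s"
      "g (x + s *\<^sub>R a + s *\<^sub>R b) - g (x + s *\<^sub>R a) - g (x + s *\<^sub>R b) + g x
        = s\<^sup>2 * DDg a b (x + \<sigma> *\<^sub>R a + \<tau> *\<^sub>R b)"
      by (rule second_difference_mvt[OF g D s])
    obtain \<sigma>' \<tau>' where st': "0 < \<sigma>'" "\<sigma>' < s" "0 < \<tau>'" "\<tau>' < s"
      "g (x + s *\<^sub>R b + s *\<^sub>R a) - g (x + s *\<^sub>R b) - g (x + s *\<^sub>R a) + g x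
        = s\<^sup>2 * DDg b a (x + \<sigma>' *\<^sub>R b + \<tau>' *\<^sub>R a)"
      by (rule second_difference_mvt[OF g D s])
    have near: "norm (x + \<sigma> *\<^sub>R a + \<tau> *\<^sub>R b - x) \<le> s * (norm a + norm b)"
      if "0 < \<sigma>" "\<sigma> < s" "0 < \<tau>" "\<tau> < s" for \<sigma> \<tau> :: real and a b :: 'a
    proof -
      have "norm (\<sigma> *\<^sub>R a + \<tau> *\<^sub>R b) \<le> \<sigma> * norm a + \<tau> * norm b"
        using norm_triangle_ineq[of "\<sigma> *\<^sub>R a" "\<tau> *\<^sub>R b"] that by simp
      also have "\<dots> \<le> s * norm a + s * norm b"
        using that by (intro add_mono mult_right_mono) auto
      finally show ?thesis
        by (simp add: algebra_simps)
    qed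
    have "x + s *\<^sub>R b + s *\<^sub>R a = x + s *\<^sub>R a + s *\<^sub>R b"
      by simp
    then have "s\<^sup>2 * DDg a b (x + \<sigma> *\<^sub>R a + \<tau> *\<^sub>R b) = s\<^sup>2 * DDg b a (x + \<sigma>' *\<^sub>R b + \<tau>' *\<^sub>R a)"
      using st(5) st'(5) by (simp only:)
    then show ?thesis
      using near[OF st(1-4), of a b] near[OF st'(1-4), of b a] s
      by (intro exI conjI) (auto simp: add.commute)
  qed
  show ?thesis
  proof (rule ccontr)
    assume neq: "DDg a b x \<noteq> DDg b a x"
    define e where "e = \<bar>DDg a b x - DDg b a x\<bar> / 2"
    have e: "e > 0"
      using neq by (simp add: e_def)
    obtain d1 where d1: "d1 > 0" "\<And>y. dist y x < d1 \<Longrightarrow> dist (DDg a b y) (DDg a b x) < e"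
      using cont(1) e unfolding continuous_at by (metis LIM_def dist_self)
    obtain d2 where d2: "d2 > 0" "\<And>y. dist y x < d2 \<Longrightarrow> dist (DDg b a y) (DDg b a x) < e"
      using cont(2) e unfolding continuous_at by (metis LIM_def dist_self)
    \<comment> \<open>The summand \<open>1\<close> keeps the denominator positive when
      \<open>a\<close> and \<open>b\<close> both vanish.\<close>
    define s where "s = min d1 d2 / (norm a + norm b + 1)"
    have pos: "norm a + norm b + 1 > 0"
      by (smt (verit) norm_ge_zero)
    have s: "s > 0"
      using d1 d2 pos by (simp add: s_def)
    have "s * (norm a + norm b) < s * (norm a + norm b + 1)"
      using s by simp
    also have "\<dots> = min d1 d2"
      using pos by (simp add: s_def)
    finally have small: "s * (norm a + norm b) < min d1 d2" .
    obtain y z where yz: "norm (y - x) \<le> s * (norm a + norm b)" "norm (z - x) \<le> s * (norm a + norm b)"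
      "DDg a b y = DDg b a z"
      using ex[OF s] by blast
    have "dist y x < d1" "dist z x < d2"
      using small yz(1,2) by (auto simp: dist_norm)
    then have "dist (DDg a b y) (DDg a b x) < e" "dist (DDg b a z) (DDg b a x) < e"
      using d1(2) d2(2) by blast+
    then show False
      unfolding e_def using yz(3) by (simp add: dist_real_def abs_if split: if_splits)
  qed
qed

lemma nderiv_swap:
  assumes f: "cont_diff n f" and "Suc (Suc (length ds)) \<le> n"
  shows "nderiv f (a # b # ds) = nderiv f (b # a # ds)"
proof
  fix x
  show "nderiv f (a # b # ds) x = nderiv f (b # a # ds) x"
  proof (rule mixed_derivatives_eq[where Dg = "\<lambda>c. nderiv f (c # ds)" and g = "nderiv f ds"
        and DDg = "\<lambda>d c. nderiv f (d # c # ds)"])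
    show "(nderiv f ds has_derivative (\<lambda>d. nderiv f (d # ds) x)) (at x)" for x
      using assms by (intro cont_diff_has_derivative) auto
    show "(nderiv f (c # ds) has_derivative (\<lambda>d. nderiv f (d # c # ds) x)) (at x)" for c x
      using assms by (intro cont_diff_has_derivative) auto
    show "continuous (at x) (nderiv f (c # d # ds))" for c d
      using cont_diff_continuous[OF f, of "c # d # ds"] assms(2)
      by (auto simp: continuous_on_eq_continuous_at)
    then show "continuous (at x) (nderiv f (c # d # ds))" for c d .
  qed
qed

text \<open>If the heads differ, the head of \<open>ys\<close> occurs in the tail of
  \<open>xs\<close>. The induction hypothesis brings it to second place, \<open>nderiv_swap\<close>
  exchanges the first two entries, and the hypothesis applies again to the tails.\<close>

lemma nderiv_mset:
  assumes f: "cont_diff n f"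
  shows "mset xs = mset ys \<Longrightarrow> length xs \<le> n \<Longrightarrow> nderiv f xs = nderiv f ys"
proof (induction "length xs" arbitrary: xs ys)
  case (Suc l)
  obtain a xs' where xs: "xs = a # xs'"
    using Suc.hyps(2) by (cases xs) auto
  obtain b ys' where ys: "ys = b # ys'"
    using Suc.prems(1) xs by (cases ys) auto
  show ?case
  proof (cases "a = b")
    case True
    then have "nderiv f xs' = nderiv f ys'"
      using Suc.hyps Suc.prems xs ys by (intro Suc.hyps(1)) auto
    then show ?thesis
      by (simp add: xs ys True)
  next
    case False
    have len: "length ys' = length xs'"
      using Suc.prems(1) xs ys by (metis length_Cons mset_eq_length nat.inject)
    have "b \<in> set xs'"
      using Suc.prems(1) False xs ys by (metis insertE list.set_intros(1) list.simps(15) set_mset_mset)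
    then obtain us vs where "xs' = us @ b # vs"
      by (meson split_list)
    then have zs: "mset xs' = mset (b # us @ vs)"
      by simp
    then have zs': "mset ys' = mset (a # us @ vs)"
      using Suc.prems(1) xs ys by simp
    have lz: "length xs' = Suc (length (us @ vs))"
      using arg_cong[OF zs, of size] by simp
    have "nderiv f xs' = nderiv f (b # us @ vs)"
      using Suc.hyps Suc.prems xs zs by (intro Suc.hyps(1)) auto
    then have "nderiv f xs = nderiv f (a # b # us @ vs)"
      by (simp add: xs)
    also have "\<dots> = nderiv f (b # a # us @ vs)"
      using Suc.prems(2) xs lz by (intro nderiv_swap[OF f]) auto
    also have "nderiv f (a # us @ vs) = nderiv f ys'"
      using Suc.hyps Suc.prems xs zs' len lz by (intro Suc.hyps(1)) auto
    then have "nderiv f (b # a # us @ vs) = nderiv f ys"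
      by (simp add: ys)
    finally show ?thesis .
  qed
qed simp

lemma sym_multilinear_nderiv:
  assumes f: "cont_diff n f" and "k \<le> n"
  shows "sym_multilinear k (\<lambda>ds. nderiv f ds x)"
  unfolding sym_multilinear_def
proof (intro conjI allI impI)
  fix xs ys :: "'a list" assume "length xs = k" "mset xs = mset ys"
  then show "nderiv f xs x = nderiv f ys x"
    using nderiv_mset[OF f, of xs ys] assms(2) by simp
next
  fix ds :: "'a list" assume "Suc (length ds) = k"
  then have "(nderiv f ds has_derivative (\<lambda>d. nderiv f (d # ds) x)) (at x)"
    using assms by (intro cont_diff_has_derivative) auto
  then show "linear (\<lambda>d. nderiv f (d # ds) x)"
    by (rule has_derivative_linear)
qed

subsection \<open>Taylor estimates\<close>

text \<open>Only a Lipschitz bound at \<open>0\<close> is known for the last function, so the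
  estimate is integrated: the remainder of the shifted family is the derivative of the remainder,
  and a monotonicity argument raises the order by one.\<close>

lemma taylor_remainder_real:
  fixes \<psi> :: "nat \<Rightarrow> real \<Rightarrow> real"
  assumes "\<And>j t. j < n \<Longrightarrow> (\<psi> j has_real_derivative \<psi> (Suc j) t) (at t)"
    and "\<And>t. t \<ge> 0 \<Longrightarrow> \<bar>\<psi> n t - \<psi> n 0\<bar> \<le> K * t"
    and "t \<ge> 0"
  shows "\<bar>\<psi> 0 t - (\<Sum>j\<le>n. \<psi> j 0 * t ^ j / fact j)\<bar> \<le> K * t ^ Suc n / fact (Suc n)"
  using assms
proof (induction n arbitrary: \<psi> t)
  case (Suc n)
  define R where "R = (\<lambda>t. \<psi> 0 t - (\<Sum>j\<le>Suc n. \<psi> j 0 * t ^ j / fact j))"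
  define R' where "R' = (\<lambda>t. \<psi> 1 t - (\<Sum>j\<le>n. \<psi> (Suc j) 0 * t ^ j / fact j))"
  have IH: "\<bar>R' t\<bar> \<le> K * t ^ Suc n / fact (Suc n)" if "t \<ge> 0" for t
    using Suc.IH[of "\<lambda>j. \<psi> (Suc j)"] Suc.prems that by (simp add: R'_def)
  have R: "(R has_real_derivative R' t) (at t)" for t
  proof -
    have "((\<lambda>t. \<psi> j 0 * t ^ j / fact j) has_real_derivative \<psi> j 0 * (real j * t ^ (j - 1)) / fact j) (at t)"
      for j
      by (auto intro!: derivative_eq_intros)
    then have "((\<lambda>t. \<Sum>j\<le>Suc n. \<psi> j 0 * t ^ j / fact j) has_real_derivative
        (\<Sum>j\<le>Suc n. \<psi> j 0 * (real j * t ^ (j - 1)) / fact j)) (at t)"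
      by (intro DERIV_sum)
    also have "(\<Sum>j\<le>Suc n. \<psi> j 0 * (real j * t ^ (j - 1)) / fact j) = (\<Sum>j\<le>n. \<psi> (Suc j) 0 * t ^ j / fact j)"
      by (subst sum.atMost_Suc_shift) (simp add: field_simps del: of_nat_Suc)
    finally show ?thesis
      unfolding R_def R'_def using Suc.prems(1)[of 0] by (intro DERIV_diff) auto
  qed
  have bound: "((\<lambda>t. K * t ^ Suc (Suc n) / fact (Suc (Suc n))) has_real_derivative
      K * t ^ Suc n / fact (Suc n)) (at t)" for t
  proof -
    have "((\<lambda>t. K / fact (Suc (Suc n)) * t ^ Suc (Suc n)) has_real_derivative
        K / fact (Suc (Suc n)) * (real (Suc (Suc n)) * t ^ (Suc (Suc n) - Suc 0))) (at t)"
      by (intro DERIV_cmult DERIV_pow)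
    moreover have "K / fact (Suc (Suc n)) * (real (Suc (Suc n)) * w) = K * w / fact (Suc n)" for w
      by (subst fact_Suc) (simp del: of_nat_Suc fact_Suc)
    ultimately show ?thesis
      by (simp del: of_nat_Suc fact_Suc power_Suc)
  qed
  have R0: "R 0 = 0"
    unfolding R_def by (subst sum.atMost_Suc_shift) simp
  \<comment> \<open>The sign \<open>c\<close> covers both inequalities of the absolute value at
    once.\<close>
  have mono: "0 \<le> c * R t + K * t ^ Suc (Suc n) / fact (Suc (Suc n))" if "\<bar>c\<bar> = 1" for c
  proof -
    have "c * R 0 + K * 0 ^ Suc (Suc n) / fact (Suc (Suc n))
        \<le> c * R t + K * t ^ Suc (Suc n) / fact (Suc (Suc n))"
    proof (rule DERIV_nonneg_imp_nondecreasing[OF \<open>t \<ge> 0\<close>])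
      fix s :: real assume "0 \<le> s" "s \<le> t"
      have "((\<lambda>t. c * R t + K * t ^ Suc (Suc n) / fact (Suc (Suc n))) has_real_derivative
          c * R' s + K * s ^ Suc n / fact (Suc n)) (at s)"
        by (intro DERIV_add DERIV_cmult R bound)
      moreover have "0 \<le> c * R' s + K * s ^ Suc n / fact (Suc n)"
        using IH[OF \<open>0 \<le> s\<close>] that by (auto simp: abs_if split: if_splits)
      ultimately show "\<exists>y. ((\<lambda>t. c * R t + K * t ^ Suc (Suc n) / fact (Suc (Suc n)))
          has_real_derivative y) (at s) \<and> 0 \<le> y"
        by blast
    qed
    then show ?thesis
      by (simp add: R0)
  qed
  have "\<bar>R t\<bar> \<le> K * t ^ Suc (Suc n) / fact (Suc (Suc n))"
    using mono[of 1] mono[of "-1"] by (simp add: abs_le_iff del: fact_Suc power_Suc)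
  then show ?case
    by (simp only: R_def)
qed simp

subsection \<open>Gradients and errors of the models\<close>

lemma grad_apply:
  assumes "(f has_derivative f') (at x)"
  shows "blinfun_apply (grad f x) = f'"
  using assms has_derivative_bounded_linear[OF assms]
  by (simp add: grad_def bounded_linear_Blinfun_apply flip: frechet_derivative_at)

lemma grad_apply_nderiv:
  assumes "cont_diff n f" "n \<ge> 1"
  shows "blinfun_apply (grad f x) d = nderiv f [d] x"
  using grad_apply[OF cont_diff_has_derivative[OF assms(1), of "[]" x]] assms(2) by simp

lemma has_derivative_taylor:
  assumes f: "cont_diff n f"
  shows "((\<lambda>z. taylor n f z x) has_derivative
    (\<lambda>d. \<Sum>i = 1..n. nderiv f (d # replicate (i - 1) (y - x)) x / fact (i - 1))) (at y)"
proof -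
  have "((\<lambda>z. nderiv f (replicate i (z - x)) x / fact i) has_derivative
      (\<lambda>d. nderiv f (d # replicate (i - 1) (y - x)) x / fact (i - 1))) (at y)" if i: "i \<in> {1..n}" for i
  proof -
    have "sym_multilinear i (\<lambda>ds. nderiv f ds x)"
      using f i by (intro sym_multilinear_nderiv) auto
    from has_derivative_sym_multilinear[OF this]
    have "((\<lambda>w. nderiv f (replicate i w) x) has_derivative
        (\<lambda>d. real i * nderiv f (d # replicate (i - 1) (y - x)) x)) (at (y - x))" .
    moreover have "((\<lambda>z. z - x) has_derivative (\<lambda>d. d)) (at y)"
      by (auto intro!: derivative_eq_intros)
    ultimately have "((\<lambda>z. nderiv f (replicate i (z - x)) x) has_derivative
        (\<lambda>d. real i * nderiv f (d # replicate (i - 1) (y - x)) x)) (at y)"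
      using has_derivative_compose by fastforce
    then have "((\<lambda>z. nderiv f (replicate i (z - x)) x / fact i) has_derivative
        (\<lambda>d. real i * nderiv f (d # replicate (i - 1) (y - x)) x / fact i)) (at y)"
      by (rule bounded_linear.has_derivative[OF bounded_linear_divide])
    moreover have "fact i = real i * fact (i - 1)"
      using i by (simp add: fact_reduce)
    ultimately show ?thesis
      using i by simp
  qed
  then have "((\<lambda>z. \<Sum>i = 1..n. nderiv f (replicate i (z - x)) x / fact i) has_derivative
      (\<lambda>d. \<Sum>i = 1..n. nderiv f (d # replicate (i - 1) (y - x)) x / fact (i - 1))) (at y)"
    by (intro has_derivative_sum)
  from has_derivative_add[OF has_derivative_const this] show ?thesis
    unfolding taylor_def by (rule has_derivative_eq_rhs) simp
qed

section \<open>Taylor remainders under a Lipschitz condition\<close>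

context pos_def
begin

text \<open>The \<open>Sup\<close> in \<open>form_norm\<close> bounds its set only if the set is
  bounded above; compactness of the unit ball of \<open>pn\<close> provides this.\<close>

lemma le_form_norm:
  assumes A: "sym_multilinear n A" and d: "pn d \<le> 1"
  shows "A (replicate n d) \<le> form_norm B n A"
proof -
  have "continuous_on {d. pn d \<le> 1} (\<lambda>d. A (replicate n d))"
    using has_derivative_sym_multilinear[OF A] has_derivative_continuous continuous_at_imp_continuous_on
    by blast
  then have "compact ((\<lambda>d. A (replicate n d)) ` {d. pn d \<le> 1})"
    using compact_pnorm_cball by (rule compact_continuous_image)
  then have "bdd_above ((\<lambda>d. A (replicate n d)) ` {d. pn d \<le> 1})"
    by (rule bounded_imp_bdd_above[OF compact_imp_bounded])
  then show ?thesis
    unfolding form_norm_def using d by (intro cSUP_upper) auto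
qed

text \<open>Banach's theorem for the difference of two derivative forms: the Lipschitz condition
  bounds it on the diagonal, and the same constant serves for arbitrary arguments.\<close>

lemma nderiv_lipschitz:
  assumes f: "cont_diff n f" and L: "lipschitz_deriv B n L f" and len: "length ds = n"
  shows "\<bar>nderiv f ds x - nderiv f ds y\<bar> \<le> L * pn (x - y) * prod_list (map pn ds)"
proof (rule sym_multilinear_bound[of n "\<lambda>ds. nderiv f ds x - nderiv f ds y", OF _ _ len])
  have sm: "sym_multilinear n (\<lambda>ds. nderiv f ds x - nderiv f ds y)" for x y
    using f by (intro sym_multilinear_diff sym_multilinear_nderiv) auto
  then show "sym_multilinear n (\<lambda>ds. nderiv f ds x - nderiv f ds y)" .
  fix d assume d: "pn d = 1"
  \<comment> \<open>\<open>form_norm\<close> bounds values from one side; exchanging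
    \<open>x\<close> and \<open>y\<close> supplies the other.\<close>
  have "nderiv f (replicate n d) x - nderiv f (replicate n d) y \<le> L * pn (x - y)" for x y
    using le_form_norm[OF sm, of d x y] L d by (force simp: lipschitz_deriv_def intro: order_trans)
  from this[of x y] this[of y x]
  show "\<bar>nderiv f (replicate n d) x - nderiv f (replicate n d) y\<bar> \<le> L * pn (x - y)"
    by (simp add: pnorm_diff_commute[of y x])
qed

text \<open>Between a unit vector \<open>e\<close> and \<open>0\<close> the Lipschitz estimate
  bounds an absolute value by \<open>L\<close>.\<close>

lemma lipschitz_deriv_nonneg:
  assumes "cont_diff n f" "lipschitz_deriv B n L f"
  shows "L \<ge> 0"
proof -
  obtain e where e: "pn e = 1"
    using ex_pnorm_1 by blast
  have "prod_list (map pn (replicate n e)) = 1"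
    by (simp add: e)
  then show ?thesis
    using nderiv_lipschitz[OF assms, of "replicate n e" e 0] e by simp
qed

text \<open>One-variable Taylor expansion from \<open>x\<close> towards \<open>x + v\<close> with a
  fixed tail \<open>es\<close>: the empty tail gives the error in the value, the tail
  \<open>[d]\<close> the error in the gradient.\<close>

lemma nderiv_taylor_remainder:
  assumes f: "cont_diff n f" and L: "lipschitz_deriv B n L f" and n: "k + length es = n"
  shows "\<bar>nderiv f es (x + v) - (\<Sum>j\<le>k. nderiv f (replicate j v @ es) x / fact j)\<bar>
    \<le> L * pn v ^ Suc k * prod_list (map pn es) / fact (Suc k)"
proof -
  define \<psi> where "\<psi> = (\<lambda>j t. nderiv f (replicate j v @ es) (x + t *\<^sub>R v))"
  have "\<bar>\<psi> 0 1 - (\<Sum>j\<le>k. \<psi> j 0 * 1 ^ j / fact j)\<bar>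
      \<le> (L * pn v ^ Suc k * prod_list (map pn es)) * 1 ^ Suc k / fact (Suc k)"
  proof (rule taylor_remainder_real)
    fix j :: nat and t :: real assume "j < k"
    then have "(nderiv f (replicate j v @ es) has_derivative
        (\<lambda>d. nderiv f (d # replicate j v @ es) (x + t *\<^sub>R v))) (at (x + t *\<^sub>R v))"
      using n by (intro cont_diff_has_derivative[OF f]) auto
    from has_field_derivative_along_line[OF this]
    show "(\<psi> j has_real_derivative \<psi> (Suc j) t) (at t)"
      by (simp add: \<psi>_def)
  next
    fix t :: real assume t: "t \<ge> 0"
    have "\<bar>\<psi> k t - \<psi> k 0\<bar> \<le> L * pn (t *\<^sub>R v) * prod_list (map pn (replicate k v @ es))"
      using nderiv_lipschitz[OF f L, of "replicate k v @ es" "x + t *\<^sub>R v" x] n by (simp add: \<psi>_def)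
    also have "prod_list (map pn (replicate k v @ es)) = pn v ^ k * prod_list (map pn es)"
      by (simp add: prod_list_replicate)
    finally show "\<bar>\<psi> k t - \<psi> k 0\<bar> \<le> L * pn v ^ Suc k * prod_list (map pn es) * t"
      using t by (simp add: pnorm_scaleR mult_ac)
  qed simp
  then show ?thesis
    by (simp add: \<psi>_def)
qed

lemma taylor_error:
  assumes "cont_diff n f" "lipschitz_deriv B n L f"
  shows "\<bar>f y - taylor n f y x\<bar> \<le> L / fact (n + 1) * pn (y - x) ^ (n + 1)"
proof -
  have "(\<Sum>j\<le>n. nderiv f (replicate j (y - x)) x / fact j) = taylor n f y x"
    unfolding taylor_def atLeast0AtMost[symmetric] by (subst sum.atLeast_Suc_atMost) auto
  then show ?thesis
    using nderiv_taylor_remainder[OF assms, of n "[]" x "y - x"] by simp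
qed

text \<open>The derivative of the Taylor polynomial in direction \<open>d\<close> is the Taylor
  polynomial of order \<open>n - 1\<close> of the directional derivative; symmetry moves
  \<open>d\<close> from the head to the tail, where the remainder estimate expects it.\<close>

lemma grad_taylor_error:
  assumes f: "cont_diff n f" and L: "lipschitz_deriv B n L f" and n: "n \<ge> 1"
  shows "dnorm B (grad f y - grad (\<lambda>z. taylor n f z x) y) \<le> L / fact n * pn (y - x) ^ n"
proof (rule dnorm_leI)
  fix d
  obtain k where k: "n = Suc k"
    using n by (cases n) auto
  have "blinfun_apply (grad (\<lambda>z. taylor n f z x) y) d
      = (\<Sum>i = 1..n. nderiv f (d # replicate (i - 1) (y - x)) x / fact (i - 1))"
    by (simp add: grad_apply[OF has_derivative_taylor[OF f]])
  also have "\<dots> = (\<Sum>j\<le>k. nderiv f (d # replicate j (y - x)) x / fact j)"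
    unfolding atLeast0AtMost[symmetric] k One_nat_def sum.shift_bounds_cl_Suc_ivl by simp
  also have "\<dots> = (\<Sum>j\<le>k. nderiv f (replicate j (y - x) @ [d]) x / fact j)"
  proof (intro sum.cong refl)
    fix j assume "j \<in> {..k}"
    then have "nderiv f (d # replicate j (y - x)) = nderiv f (replicate j (y - x) @ [d])"
      using k by (intro nderiv_mset[OF f]) auto
    then show "nderiv f (d # replicate j (y - x)) x / fact j = nderiv f (replicate j (y - x) @ [d]) x / fact j"
      by simp
  qed
  finally have "blinfun_apply (grad f y - grad (\<lambda>z. taylor n f z x) y) d
      = nderiv f [d] y - (\<Sum>j\<le>k. nderiv f (replicate j (y - x) @ [d]) x / fact j)"
    by (simp add: blinfun.diff_left grad_apply_nderiv[OF f n] del: nderiv.simps)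
  also have "\<dots> \<le> L * pn (y - x) ^ n * pn d / fact n"
    using nderiv_taylor_remainder[OF f L, of k "[d]" x "y - x"] k by (simp del: nderiv.simps)
  finally show "blinfun_apply (grad f y - grad (\<lambda>z. taylor n f z x) y) d \<le> L / fact n * pn (y - x) ^ n * pn d"
    by simp
qed (use lipschitz_deriv_nonneg[OF f L] in simp)

section \<open>Regularised models\<close>

lemma has_derivative_regularization:
  assumes "n \<ge> 1"
  shows "((\<lambda>z. c / fact (n + 1) * pn (z - x) ^ (n + 1)) has_derivative
    blinfun_apply ((c / fact n * pn (y - x) ^ (n - 1)) *\<^sub>R B (y - x))) (at y)"
proof -
  have "((\<lambda>z. z - x) has_derivative (\<lambda>d. d)) (at y)"
    by (auto intro!: derivative_eq_intros)
  from has_derivative_compose[OF this has_derivative_pnorm_power[OF assms]]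
  have "((\<lambda>z. pn (z - x) ^ (n + 1)) has_derivative
      (\<lambda>d. real (n + 1) * pn (y - x) ^ (n - 1) * ip (y - x) d)) (at y)" .
  then have "((\<lambda>z. c / fact (n + 1) * pn (z - x) ^ (n + 1)) has_derivative
      (\<lambda>d. c / fact (n + 1) * (real (n + 1) * pn (y - x) ^ (n - 1) * ip (y - x) d))) (at y)"
    by (rule has_derivative_mult_right)
  moreover have "c / fact (n + 1) * (real (n + 1) * w) = c / fact n * w" for w
    by (simp add: field_simps del: of_nat_Suc)
  then have "(\<lambda>d. c / fact (n + 1) * (real (n + 1) * pn (y - x) ^ (n - 1) * ip (y - x) d)) =
      blinfun_apply ((c / fact n * pn (y - x) ^ (n - 1)) *\<^sub>R B (y - x))"
    by (intro ext) (simp only: mult.assoc blinfun.scaleR_left real_scaleR_def)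
  ultimately show ?thesis
    by (simp only:)
qed

lemma dnorm_regularization:
  assumes "n \<ge> 1"
  shows "dnorm B ((c / fact n * pn v ^ (n - 1)) *\<^sub>R B v) = \<bar>c\<bar> / fact n * pn v ^ n"
  using assms by (cases n) (simp_all add: dnorm_scaleR dnorm_B abs_mult)

lemma grad_con_model:
  assumes f: "cont_diff n f" and n: "n \<ge> 1"
  shows "grad (\<lambda>z. con_model B n c f z x) y
    = grad (\<lambda>z. taylor n f z x) y + (c / fact n * pn (y - x) ^ (n - 1)) *\<^sub>R B (y - x)"
proof (rule blinfun_eqI)
  fix d
  show "blinfun_apply (grad (\<lambda>z. con_model B n c f z x) y) d =
      blinfun_apply (grad (\<lambda>z. taylor n f z x) y + (c / fact n * pn (y - x) ^ (n - 1)) *\<^sub>R B (y - x)) d"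
    unfolding con_model_def blinfun.add_left grad_apply[OF has_derivative_taylor[OF f]]
      grad_apply[OF has_derivative_add[OF has_derivative_taylor[OF f] has_derivative_regularization[OF n]]]
    by (rule refl)
qed

lemma grad_obj_model:
  assumes f: "cont_diff p f" and p: "p \<ge> 1" and q: "q \<ge> 1"
  shows "grad (\<lambda>z. obj_model B p q c c' f z x) y
    = grad (\<lambda>z. taylor p f z x) y + (c / fact p * pn (y - x) ^ (p - 1)) *\<^sub>R B (y - x)
      + (c' / fact q * pn (y - x) ^ (q - 1)) *\<^sub>R B (y - x)"
proof (rule blinfun_eqI)
  fix d
  show "blinfun_apply (grad (\<lambda>z. obj_model B p q c c' f z x) y) d =
      blinfun_apply (grad (\<lambda>z. taylor p f z x) y + (c / fact p * pn (y - x) ^ (p - 1)) *\<^sub>R B (y - x)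
        + (c' / fact q * pn (y - x) ^ (q - 1)) *\<^sub>R B (y - x)) d"
    unfolding obj_model_def blinfun.add_left grad_apply[OF has_derivative_taylor[OF f]]
      grad_apply[OF has_derivative_add[OF has_derivative_add[OF has_derivative_taylor[OF f]
        has_derivative_regularization[OF p]] has_derivative_regularization[OF q]]]
    by (rule refl)
qed

lemma grad_con_model_error:
  assumes f: "cont_diff n f" and L: "lipschitz_deriv B n L f" and n: "n \<ge> 1" and c: "c \<ge> 0"
  shows "dnorm B (grad f y - grad (\<lambda>z. con_model B n c f z x) y) \<le> (c + L) / fact n * pn (y - x) ^ n"
proof -
  have eq: "grad f y - grad (\<lambda>z. con_model B n c f z x) y
      = (grad f y - grad (\<lambda>z. taylor n f z x) y) - (c / fact n * pn (y - x) ^ (n - 1)) *\<^sub>R B (y - x)"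
    by (simp add: grad_con_model[OF f n])
  show ?thesis
    unfolding eq using dnorm_diff[of "grad f y - grad (\<lambda>z. taylor n f z x) y"
        "(c / fact n * pn (y - x) ^ (n - 1)) *\<^sub>R B (y - x)"]
      grad_taylor_error[OF f L n, of y x] c
    unfolding dnorm_regularization[OF n] by (simp add: add_divide_distrib distrib_right)
qed

lemma grad_obj_model_error:
  assumes f: "cont_diff p f" and L: "lipschitz_deriv B p L f" and p: "p \<ge> 1" and q: "q \<ge> 1"
    and c: "c \<ge> 0" "c' \<ge> 0"
  shows "dnorm B (grad f y - grad (\<lambda>z. obj_model B p q c c' f z x) y)
    \<le> (L + c) / fact p * pn (y - x) ^ p + c' / fact q * pn (y - x) ^ q"
proof -
  let ?u = "(c / fact p * pn (y - x) ^ (p - 1)) *\<^sub>R B (y - x)"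
    and ?v = "(c' / fact q * pn (y - x) ^ (q - 1)) *\<^sub>R B (y - x)"
  have eq: "grad f y - grad (\<lambda>z. obj_model B p q c c' f z x) y
      = (grad f y - grad (\<lambda>z. taylor p f z x) y) - ?u - ?v"
    by (simp add: grad_obj_model[OF f p q])
  show ?thesis
    unfolding eq using dnorm_diff[of "grad f y - grad (\<lambda>z. taylor p f z x) y - ?u" ?v]
      dnorm_diff[of "grad f y - grad (\<lambda>z. taylor p f z x) y" ?u]
      grad_taylor_error[OF f L p, of y x] c
    unfolding dnorm_regularization[OF p] dnorm_regularization[OF q]
    by (simp add: add_divide_distrib distrib_right)
qed

text \<open>The first bound passes approximate feasibility from the model to the constraint; the
  second serves to control the complementarity products.\<close>

lemma le_con_model:
  assumes "cont_diff n f" "lipschitz_deriv B n L f"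
  shows "f y \<le> con_model B n c f y x - (c - L) / fact (n + 1) * pn (y - x) ^ (n + 1)"
    and "con_model B n c f y x \<le> f y + (c + L) / fact (n + 1) * pn (y - x) ^ (n + 1)"
  using taylor_error[OF assms, of y x]
  by (simp_all add: con_model_def add_divide_distrib diff_divide_distrib distrib_right left_diff_distrib
      del: fact_Suc)

text \<open>The regularisation absorbs the Taylor error; what remains of it is the guaranteed
  decrease per step.\<close>

lemma le_obj_model:
  assumes "cont_diff p f" "lipschitz_deriv B p L f"
  shows "f y + (c - L) / fact (p + 1) * pn (y - x) ^ (p + 1) + c' / fact (q + 1) * pn (y - x) ^ (q + 1)
    \<le> obj_model B p q c c' f y x"
  using taylor_error[OF assms, of y x]
  by (simp add: obj_model_def diff_divide_distrib left_diff_distrib del: fact_Suc)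

end

subsection \<open>Decrease of the objective and rate of convergence\<close>

lemma power_Suc_powr:
  fixes a :: real
  assumes "a \<ge> 0" "s \<ge> 1"
  shows "(a ^ (s + 1)) powr (real s / real (s + 1)) = a ^ s"
proof (cases "a = 0")
  case False
  then have "(a ^ (s + 1)) powr (real s / real (s + 1)) = (a powr real (s + 1)) powr (real s / real (s + 1))"
    using assms(1) by (simp only: powr_realpow)
  also have "\<dots> = a powr real s"
    by (simp only: powr_powr) simp
  finally show ?thesis
    using False assms(1) by (simp add: powr_realpow)
qed (use assms(2) in simp)

text \<open>Pigeonhole: one of the \<open>k\<close> summands is at most \<open>\<delta> / k\<close>,
  and the exponent \<open>s / (s + 1)\<close> converts \<open>r j ^ (s + 1)\<close> into
  \<open>r j ^ s\<close>.\<close>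

lemma min_power_rate:
  fixes r :: "nat \<Rightarrow> real"
  assumes r: "\<And>j. r j \<ge> 0" and c: "c > 0" and s: "s \<ge> 1" and k: "k \<ge> 1"
    and sum: "(\<Sum>j<k. c * r j ^ (s + 1)) \<le> \<delta>"
  shows "\<exists>j<k. r j ^ s \<le> \<delta> powr (real s / real (s + 1))
    / (c powr (real s / real (s + 1)) * real k powr (real s / real (s + 1)))"
proof -
  define a where "a = real s / real (s + 1)"
  have "\<exists>j<k. c * r j ^ (s + 1) \<le> \<delta> / k"
  proof (rule ccontr)
    assume "\<not> ?thesis"
    then have "\<delta> / k < c * r j ^ (s + 1)" if "j < k" for j
      using that by (metis not_le)
    then have "(\<Sum>j<k. \<delta> / k) < (\<Sum>j<k. c * r j ^ (s + 1))"
      using k by (intro sum_strict_mono) (auto simp: lessThan_empty_iff)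
    then show False
      using sum k by simp
  qed
  then obtain j where j: "j < k" "c * r j ^ (s + 1) \<le> \<delta> / k"
    by blast
  have \<delta>: "\<delta> \<ge> 0"
    by (rule order_trans[OF _ sum]) (use r c in \<open>auto intro!: sum_nonneg\<close>)
  have "r j ^ s = (r j ^ (s + 1)) powr a"
    unfolding a_def by (rule power_Suc_powr[OF r s, symmetric])
  also have "\<dots> \<le> (\<delta> / (c * k)) powr a"
    using j(2) c k r by (intro powr_mono2) (auto simp: a_def field_simps)
  also have "\<dots> = \<delta> powr a / (c powr a * real k powr a)"
    using \<delta> c by (simp add: powr_divide powr_mult)
  finally show ?thesis
    using j(1) by (auto simp: a_def)
qed

text \<open>The subgradients are fixed once and for all, so that the optimality measure becomes a
  sequence; \<open>\<Lambda> (Suc k)\<close> belongs to \<open>x (Suc k)\<close>.\<close>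

locale mta = pos_def B
  for B :: "'a::euclidean_space \<Rightarrow> 'a \<Rightarrow>\<^sub>L real" +
  fixes p q m :: nat
    and F0 :: "'a \<Rightarrow> real" and Fc :: "nat \<Rightarrow> 'a \<Rightarrow> real" and h :: "'a \<Rightarrow> ereal"
    and Lp Mp M \<eta>1 \<eta>2 \<eta>3 D Cu :: real and Lq Mq :: "nat \<Rightarrow> real"
    and x :: "nat \<Rightarrow> 'a" and u :: "nat \<Rightarrow> nat \<Rightarrow> real" and \<Lambda> :: "nat \<Rightarrow> 'a \<Rightarrow>\<^sub>L real"
  assumes p: "p \<ge> 1" and q: "q \<ge> 1"
    and smooth: "smoothness_assumption B p q m Lp Lq F0 Fc h"
    and \<eta>: "\<eta>1 > 0" "\<eta>3 > 0"
    and Mp: "Mp > Lp" and M: "M > 0" and Mq: "\<And>i. i \<in> {1..m} \<Longrightarrow> Mq i \<ge> Lq i + \<eta>3"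
    and start: "x 0 \<in> feasible m Fc" "x 0 \<in> edom h"
    and kkt: "\<And>k. a_kkt B p q m Mp M Mq \<eta>1 \<eta>2 \<eta>3 F0 Fc h (x k) (x (Suc k)) (u (Suc k)) (\<Lambda> (Suc k))"
    and descent: "\<And>k. ereal (obj_model B p q Mp M F0 (x (Suc k)) (x k)) + h (x (Suc k))
            \<le> objective F0 h (x k)"
    and D: "D > 0" "\<And>k. pn (x k) \<le> D"
    and Cu: "Cu > 0" "\<And>k. k \<ge> 1 \<Longrightarrow> L2_set (u k) {1..m} \<le> Cu"
begin

abbreviation r :: "nat \<Rightarrow> real" where "r k \<equiv> pn (x (Suc k) - x k)"

abbreviation C1 :: real where "C1 \<equiv> const_C1 p Lp Mp"

abbreviation C2 :: real where "C2 \<equiv> const_C2 q m Lq Mq M \<eta>2 Cu"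

abbreviation opt :: "nat \<Rightarrow> real" where "opt k \<equiv> opt_measure B q m F0 Fc (x k) (u k) (\<Lambda> k)"

section \<open>Feasibility of the iterates and residuals of the KKT conditions\<close>

lemma F0: "cont_diff p F0" "lipschitz_deriv B p Lp F0"
  and Fc: "i \<in> {1..m} \<Longrightarrow> cont_diff q (Fc i)" "i \<in> {1..m} \<Longrightarrow> lipschitz_deriv B q (Lq i) (Fc i)"
  and h: "proper_fun h"
  using smooth by (auto simp: smoothness_assumption_def)

lemma Lp_nonneg: "Lp \<ge> 0"
  by (rule lipschitz_deriv_nonneg[OF F0])

lemma Lq_nonneg: "i \<in> {1..m} \<Longrightarrow> Lq i \<ge> 0"
  by (rule lipschitz_deriv_nonneg[OF Fc])

lemma Mq_pos: "i \<in> {1..m} \<Longrightarrow> Mq i > 0"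
  using Mq Lq_nonneg \<eta>(2) by (smt (verit))

lemma u_nonneg: "i \<in> {1..m} \<Longrightarrow> u (Suc k) i \<ge> 0"
  using kkt[of k] by (simp add: a_kkt_def)

lemma u_le: "i \<in> {1..m} \<Longrightarrow> u (Suc k) i \<le> Cu"
  using member_le_L2_set[of "{1..m}" i "u (Suc k)"] Cu(2)[of "Suc k"] by auto

lemma subgradient: "\<Lambda> (Suc k) \<in> subdiff h (x (Suc k))"
  using kkt[of k] by (simp add: a_kkt_def)

lemma stationary:
  "dnorm B (grad (\<lambda>z. obj_model B p q Mp M F0 z (x k)) (x (Suc k)) + \<Lambda> (Suc k)
    + (\<Sum>i = 1..m. u (Suc k) i *\<^sub>R grad (\<lambda>z. con_model B q (Mq i) (Fc i) z (x k)) (x (Suc k))))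
   \<le> \<eta>1 * r k ^ min p q"
  using kkt[of k] by (simp add: a_kkt_def)

lemma complementarity:
  "i \<in> {1..m} \<Longrightarrow> \<bar>u (Suc k) i * con_model B q (Mq i) (Fc i) (x (Suc k)) (x k)\<bar>
    \<le> \<eta>2 / fact (q + 1) * r k ^ (q + 1)"
  using kkt[of k] by (simp add: a_kkt_def)

lemma con_model_le:
  "i \<in> {1..m} \<Longrightarrow> con_model B q (Mq i) (Fc i) (x (Suc k)) (x k) \<le> \<eta>3 / fact (q + 1) * r k ^ (q + 1)"
  using kkt[of k] by (simp add: a_kkt_def)

text \<open>In units of \<open>r l ^ (q + 1) / fact (q + 1)\<close>, the model lies above the
  constraint by at least \<open>Mq i - Lq i\<close> and exceeds zero by at most
  \<open>\<eta>3\<close>; the margin between \<open>Mq i\<close> and \<open>Lq i\<close> thus yields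
  exact feasibility.\<close>

lemma Fc_nonpos:
  assumes i: "i \<in> {1..m}"
  shows "Fc i (x k) \<le> 0"
proof (cases k)
  case 0
  then show ?thesis
    using start(1) i by (simp add: feasible_def)
next
  case (Suc l)
  have "Fc i (x (Suc l)) \<le> (\<eta>3 - (Mq i - Lq i)) / fact (q + 1) * r l ^ (q + 1)"
    using le_con_model(1)[OF Fc[OF i], of "x (Suc l)" "Mq i" "x l"] con_model_le[OF i, of l]
    by (simp add: diff_divide_distrib left_diff_distrib del: fact_Suc)
  also have "\<dots> \<le> 0"
    using Mq[OF i] by (intro mult_nonpos_nonneg divide_nonpos_nonneg) auto
  finally show ?thesis
    using Suc by simp
qed

lemma feasible: "x k \<in> feasible m Fc"
  using Fc_nonpos by (simp add: feasible_def)

text \<open>The exact combination of gradients is the model combination \<open>w\<close>, small by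
  approximate stationarity, plus the gradient errors \<open>g\<close> and \<open>gc i\<close>, the
  latter weighted by multipliers at most \<open>Cu\<close>.\<close>

lemma stationarity_residual:
  "dnorm B (grad F0 (x (Suc k)) + \<Lambda> (Suc k) + (\<Sum>i = 1..m. u (Suc k) i *\<^sub>R grad (Fc i) (x (Suc k))))
   \<le> C1 * r k ^ p + \<eta>1 * r k ^ min p q + (Cu * (\<Sum>i = 1..m. Mq i + Lq i) + M) / fact q * r k ^ q"
proof -
  define g where "g = grad F0 (x (Suc k)) - grad (\<lambda>z. obj_model B p q Mp M F0 z (x k)) (x (Suc k))"
  define gc where "gc = (\<lambda>i. grad (Fc i) (x (Suc k)) - grad (\<lambda>z. con_model B q (Mq i) (Fc i) z (x k)) (x (Suc k)))"
  define w where "w = grad (\<lambda>z. obj_model B p q Mp M F0 z (x k)) (x (Suc k)) + \<Lambda> (Suc k)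
    + (\<Sum>i = 1..m. u (Suc k) i *\<^sub>R grad (\<lambda>z. con_model B q (Mq i) (Fc i) z (x k)) (x (Suc k)))"
  have "grad F0 (x (Suc k)) + \<Lambda> (Suc k) + (\<Sum>i = 1..m. u (Suc k) i *\<^sub>R grad (Fc i) (x (Suc k)))
      = w + g + (\<Sum>i = 1..m. u (Suc k) i *\<^sub>R gc i)"
    by (simp add: w_def g_def gc_def scaleR_diff_right sum_subtractf)
  then have "dnorm B (grad F0 (x (Suc k)) + \<Lambda> (Suc k) + (\<Sum>i = 1..m. u (Suc k) i *\<^sub>R grad (Fc i) (x (Suc k))))
      \<le> dnorm B w + dnorm B g + dnorm B (\<Sum>i = 1..m. u (Suc k) i *\<^sub>R gc i)"
    using dnorm_triangle[of "w + g" "\<Sum>i = 1..m. u (Suc k) i *\<^sub>R gc i"] dnorm_triangle[of w g] by simp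
  moreover have "dnorm B w \<le> \<eta>1 * r k ^ min p q"
    unfolding w_def by (rule stationary)
  moreover have "dnorm B g \<le> C1 * r k ^ p + M / fact q * r k ^ q"
    unfolding g_def const_C1_def using Mp M Lp_nonneg by (intro grad_obj_model_error F0 p q) auto
  moreover have "dnorm B (\<Sum>i = 1..m. u (Suc k) i *\<^sub>R gc i)
      \<le> (\<Sum>i = 1..m. Cu * ((Mq i + Lq i) / fact q * r k ^ q))"
  proof (rule order_trans[OF dnorm_sum], rule sum_mono)
    fix i assume i: "i \<in> {1..m}"
    have "dnorm B (gc i) \<le> (Mq i + Lq i) / fact q * r k ^ q"
      unfolding gc_def using Mq_pos[OF i] by (intro grad_con_model_error Fc i q) auto
    then have "u (Suc k) i * dnorm B (gc i) \<le> Cu * ((Mq i + Lq i) / fact q * r k ^ q)"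
      using u_le[OF i, of k] u_nonneg[OF i, of k] by (intro mult_mono) auto
    then show "dnorm B (u (Suc k) i *\<^sub>R gc i) \<le> Cu * ((Mq i + Lq i) / fact q * r k ^ q)"
      using u_nonneg[OF i, of k] by (simp add: dnorm_scaleR)
  qed
  moreover have "(\<Sum>i = 1..m. Cu * ((Mq i + Lq i) / fact q * r k ^ q))
      = Cu * (\<Sum>i = 1..m. Mq i + Lq i) / fact q * r k ^ q"
    by (simp add: sum_distrib_left sum_distrib_right sum_divide_distrib mult.assoc)
  ultimately show ?thesis
    by (simp add: add_divide_distrib distrib_right)
qed

definition cK :: real where
  "cK = Cu * (MAX i \<in> {1..m}. (Mq i + Lq i) / fact (q + 1)) + \<eta>2 / fact (q + 1)"

lemma Max_coeff: "i \<in> {1..m} \<Longrightarrow>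
    (Mq i + Lq i) / fact (q + 1) \<le> (MAX i \<in> {1..m}. (Mq i + Lq i) / fact (q + 1))"
  by (rule Max_ge) auto

text \<open>With \<open>s\<close> the model value, \<open>- u F = u (s - F) - u s\<close>: the model
  error bounds the first part, approximate complementarity the second.\<close>

lemma complementarity_residual:
  assumes i: "i \<in> {1..m}"
  shows "- (u (Suc k) i * Fc i (x (Suc k))) \<le> cK * r k ^ (q + 1)"
proof -
  let ?s = "con_model B q (Mq i) (Fc i) (x (Suc k)) (x k)"
  have "?s - Fc i (x (Suc k)) \<le> (Mq i + Lq i) / fact (q + 1) * r k ^ (q + 1)"
    using le_con_model(2)[OF Fc[OF i], of "Mq i" "x (Suc k)" "x k"] by linarith
  then have "u (Suc k) i * (?s - Fc i (x (Suc k))) \<le> u (Suc k) i * ((Mq i + Lq i) / fact (q + 1) * r k ^ (q + 1))"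
    using u_nonneg[OF i] by (rule mult_left_mono)
  also have "\<dots> \<le> Cu * ((MAX i \<in> {1..m}. (Mq i + Lq i) / fact (q + 1)) * r k ^ (q + 1))"
    using u_le[OF i] u_nonneg[OF i] Mq_pos[OF i] Lq_nonneg[OF i] Max_coeff[OF i] Cu(1)
    by (intro mult_mono mult_right_mono) auto
  finally show ?thesis
    using complementarity[OF i, of k] by (simp add: cK_def algebra_simps del: fact_Suc)
qed

text \<open>Exact feasibility makes the base nonnegative, where \<open>powr\<close> is monotone; the
  exponent turns \<open>r k ^ (q + 1)\<close> into \<open>r k ^ q\<close>.\<close>

lemma complementarity_residual_powr:
  assumes i: "i \<in> {1..m}"
  shows "(- (u (Suc k) i * Fc i (x (Suc k)))) powr (real q / real (q + 1))
    \<le> cK powr (real q / real (q + 1)) * r k ^ q"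
proof -
  let ?a = "real q / real (q + 1)"
  have "0 \<le> - (u (Suc k) i * Fc i (x (Suc k)))"
    using u_nonneg[OF i] Fc_nonpos[OF i] by (simp add: mult_nonneg_nonpos)
  then have "(- (u (Suc k) i * Fc i (x (Suc k)))) powr ?a \<le> (cK * r k ^ (q + 1)) powr ?a"
    using complementarity_residual[OF i] by (intro powr_mono2) auto
  also have "\<dots> = cK powr ?a * (r k ^ (q + 1)) powr ?a"
    by (rule powr_mult)
  finally show ?thesis
    using q by (simp only: power_Suc_powr pnorm_nonneg)
qed

lemma C1_nonneg: "C1 \<ge> 0"
  using Lp_nonneg Mp by (simp add: const_C1_def)

lemma sum_coeff_nonneg: "0 \<le> (Cu * (\<Sum>i = 1..m. Mq i + Lq i) + M) / fact q"
proof -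
  have "0 \<le> (\<Sum>i = 1..m. Mq i + Lq i)"
    using Mq_pos Lq_nonneg by (intro sum_nonneg) (auto simp: less_imp_le)
  then show ?thesis
    using Cu(1) M by simp
qed

lemma C2_eq: "C2 = (Cu * (\<Sum>i = 1..m. Mq i + Lq i) + M) / fact q + cK powr (real q / real (q + 1))"
  by (simp add: const_C2_def cK_def)

lemma C2_nonneg: "C2 \<ge> 0"
  unfolding C2_eq using sum_coeff_nonneg by (intro add_nonneg_nonneg) auto

text \<open>\<open>C2\<close> adds the coefficients of \<open>r k ^ q\<close> from both kinds of
  entries whereas the measure takes a maximum, so each entry is bounded separately after adding
  nonnegative terms.\<close>

lemma opt_bound: "opt (Suc k) \<le> C1 * r k ^ p + \<eta>1 * r k ^ min p q + C2 * r k ^ q"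
  unfolding opt_measure_def
proof (rule Max.boundedI; (elim insertE imageE)?)
  let ?a = "real q / real (q + 1)"
  have nonneg: "0 \<le> C1 * r k ^ p" "0 \<le> \<eta>1 * r k ^ min p q" "0 \<le> cK powr ?a * r k ^ q"
    "0 \<le> (Cu * (\<Sum>i = 1..m. Mq i + Lq i) + M) / fact q * r k ^ q"
    by (intro mult_nonneg_nonneg C1_nonneg sum_coeff_nonneg less_imp_le[OF \<eta>(1)] zero_le_power
        pnorm_nonneg powr_ge_zero)+
  have C2: "C2 * r k ^ q
      = (Cu * (\<Sum>i = 1..m. Mq i + Lq i) + M) / fact q * r k ^ q + cK powr ?a * r k ^ q"
    unfolding C2_eq by (rule distrib_right)
  {
    fix z assume "z = dnorm B (grad F0 (x (Suc k)) + \<Lambda> (Suc k) + (\<Sum>i = 1..m. u (Suc k) i *\<^sub>R grad (Fc i) (x (Suc k))))"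
    then show "z \<le> C1 * r k ^ p + \<eta>1 * r k ^ min p q + C2 * r k ^ q"
      using stationarity_residual[of k] nonneg unfolding C2 by linarith
  next
    fix z i assume "z = (- (u (Suc k) i * Fc i (x (Suc k)))) powr ?a" "i \<in> {1..m}"
    then show "z \<le> C1 * r k ^ p + \<eta>1 * r k ^ min p q + C2 * r k ^ q"
      using complementarity_residual_powr[of i k] nonneg unfolding C2 by linarith
  }
qed auto

lemma opt_nonneg: "opt k \<ge> 0"
  unfolding opt_measure_def by (rule order_trans[OF dnorm_nonneg Max_ge]) auto

text \<open>A zero step annihilates both residual bounds because \<open>p\<close> and
  \<open>q\<close> are at least one; signs of multipliers and constraints give exact
  complementarity.\<close>

lemma kkt_of_fixed_point:
  assumes "x (Suc k) = x k"
  shows "x k \<in> kkt_points m F0 Fc h"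
proof -
  have "dnorm B (grad F0 (x k) + \<Lambda> (Suc k) + (\<Sum>i = 1..m. u (Suc k) i *\<^sub>R grad (Fc i) (x k))) \<le> 0"
    using stationarity_residual[of k] assms p q by (simp add: zero_power)
  then have "dnorm B (grad F0 (x k) + \<Lambda> (Suc k) + (\<Sum>i = 1..m. u (Suc k) i *\<^sub>R grad (Fc i) (x k))) = 0"
    by (rule order_antisym) (rule dnorm_nonneg)
  then have "grad F0 (x k) + \<Lambda> (Suc k) + (\<Sum>i = 1..m. u (Suc k) i *\<^sub>R grad (Fc i) (x k)) = 0"
    by (simp only: dnorm_eq_0_iff)
  moreover have "u (Suc k) i * Fc i (x k) = 0" if i: "i \<in> {1..m}" for i
  proof (rule order_antisym)
    show "u (Suc k) i * Fc i (x k) \<le> 0"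
      using u_nonneg[OF i] Fc_nonpos[OF i] by (rule mult_nonneg_nonpos)
    show "0 \<le> u (Suc k) i * Fc i (x k)"
      using complementarity_residual[OF i, of k] by (simp add: assms)
  qed
  moreover have "\<Lambda> (Suc k) \<in> subdiff h (x k)"
    using subgradient[of k] by (simp add: assms)
  ultimately show ?thesis
    unfolding kkt_points_def using feasible[of k] u_nonneg[of _ k] by blast
qed

section \<open>Decrease and convergence of the objective\<close>

lemma h_finite: "\<bar>h (x k)\<bar> \<noteq> \<infinity>"
proof (induction k)
  case 0
  then show ?case
    using start(2) h by (auto simp: edom_def proper_fun_def)
next
  case (Suc k)
  then have "objective F0 h (x k) < \<infinity>"
    by (cases "h (x k)") (auto simp: objective_def)
  then have "ereal (obj_model B p q Mp M F0 (x (Suc k)) (x k)) + h (x (Suc k)) < \<infinity>"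
    using descent[of k] by (rule order_le_less_trans[rotated])
  then show ?case
    using h by (auto simp: proper_fun_def)
qed

text \<open>By \<open>h_finite\<close>, \<open>real_of_ereal\<close> is applied to finite values
  only.\<close>

definition Fr :: "nat \<Rightarrow> real" where "Fr k = F0 (x k) + real_of_ereal (h (x k))"

lemma objective_eq: "objective F0 h (x k) = ereal (Fr k)"
  using h_finite[of k] by (cases "h (x k)") (auto simp: objective_def Fr_def)

lemma decrease:
  "(Mp - Lp) / fact (p + 1) * r k ^ (p + 1) + M / fact (q + 1) * r k ^ (q + 1) \<le> Fr k - Fr (Suc k)"
proof -
  have "ereal (obj_model B p q Mp M F0 (x (Suc k)) (x k) + real_of_ereal (h (x (Suc k)))) \<le> ereal (Fr k)"
    using descent[of k] h_finite[of "Suc k"] unfolding objective_eq by (simp add: ereal_real' flip: plus_ereal.simps(1))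
  then have "obj_model B p q Mp M F0 (x (Suc k)) (x k) + real_of_ereal (h (x (Suc k))) \<le> Fr k"
    by simp
  then show ?thesis
    using le_obj_model[OF F0, of "x (Suc k)" Mp "x k" M q] unfolding Fr_def[of "Suc k"] by linarith
qed

lemma decrease_terms_nonneg:
  "0 \<le> (Mp - Lp) / fact (p + 1) * r k ^ (p + 1)" "0 \<le> M / fact (q + 1) * r k ^ (q + 1)"
  using Mp M by auto

lemma decseq_Fr: "decseq Fr"
  by (rule decseq_SucI) (use decrease decrease_terms_nonneg in \<open>smt (verit)\<close>)

lemma r_le: "r k \<le> 2 * D"
  using pnorm_triangle_diff[of "x (Suc k)" "x k"] D(2)[of k] D(2)[of "Suc k"] by linarith

text \<open>A nonincreasing sequence needs only a lower bound: \<open>F0\<close> attains its minimum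
  on the compact ball of radius \<open>D\<close>, and a subgradient minorises \<open>h\<close> by an
  affine function.\<close>

lemma convergent_Fr: "convergent Fr"
proof -
  have "continuous_on {z. pn z \<le> D} F0"
    using cont_diff_continuous[OF F0(1), of "[]"] continuous_on_subset by auto
  moreover have "0 \<in> {z. pn z \<le> D}"
    using D(1) by simp
  ultimately obtain z0 where z0: "\<And>z. pn z \<le> D \<Longrightarrow> F0 z0 \<le> F0 z"
    using continuous_attains_inf[OF compact_pnorm_cball] by blast
  \<comment> \<open>The subgradient at \<open>x 1\<close>, the first iterate for which one is
    given.\<close>
  obtain w where w: "\<Lambda> (Suc 0) = B w"
    by (rule obtain_B)
  have "F0 z0 + (real_of_ereal (h (x 1)) - pn w * (2 * D)) \<le> Fr k" for k
  proof -
    have "h (x 1) + ereal (ip w (x k - x 1)) \<le> h (x k)"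
      using subgradient[of 0] by (simp add: subdiff_def w)
    then have "real_of_ereal (h (x 1)) + ip w (x k - x 1) \<le> real_of_ereal (h (x k))"
      using h_finite[of 1] h_finite[of k] by (cases "h (x 1)"; cases "h (x k)") auto
    moreover have "\<bar>ip w (x k - x 1)\<bar> \<le> pn w * (2 * D)"
    proof (rule order_trans[OF abs_ip_le_pnorm], rule mult_left_mono)
      show "pn (x k - x 1) \<le> 2 * D"
        using pnorm_triangle_diff[of "x k" "x 1"] D(2)[of k] D(2)[of 1] by linarith
    qed simp
    ultimately show ?thesis
      using z0[OF D(2)[of k]] unfolding Fr_def by linarith
  qed
  then show ?thesis
    using decseq_convergent[OF decseq_Fr] convergent_def by metis
qed

text \<open>The limit is finite, so \<open>real_of_ereal\<close> in the constant of the theorem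
  yields the true difference.\<close>

lemma lim_objective: "lim (\<lambda>k. objective F0 h (x k)) = ereal (lim Fr)"
  using convergent_Fr unfolding objective_eq by (intro limI) (simp add: convergent_LIMSEQ_iff)

lemma lim_le_Fr: "lim Fr \<le> Fr k"
  using decseq_ge[OF decseq_Fr] convergent_Fr by (simp add: convergent_LIMSEQ_iff)

text \<open>The decrements of a convergent sequence vanish, and they dominate a positive multiple of
  \<open>r k ^ (q + 1)\<close>.\<close>

lemma r_tendsto_0: "r \<longlonglongrightarrow> 0"
proof -
  have Fr: "Fr \<longlonglongrightarrow> lim Fr"
    using convergent_Fr by (simp add: convergent_LIMSEQ_iff)
  then have "(\<lambda>k. (Fr k - Fr (Suc k)) * (fact (q + 1) / M)) \<longlonglongrightarrow> (lim Fr - lim Fr) * (fact (q + 1) / M)"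
    by (intro tendsto_intros LIMSEQ_Suc)
  then have lim: "(\<lambda>k. (Fr k - Fr (Suc k)) * (fact (q + 1) / M)) \<longlonglongrightarrow> 0"
    by simp
  have "(\<lambda>k. r k ^ (q + 1)) \<longlonglongrightarrow> 0"
  proof (rule real_tendsto_sandwich[OF _ _ tendsto_const lim]; rule always_eventually; rule allI)
    fix k
    have "M / fact (q + 1) * r k ^ (q + 1) \<le> Fr k - Fr (Suc k)"
      using decrease[of k] decrease_terms_nonneg[of k] by linarith
    then show "r k ^ (q + 1) \<le> (Fr k - Fr (Suc k)) * (fact (q + 1) / M)"
      using M by (simp add: field_simps del: fact_Suc)
  qed simp
  then have "(\<lambda>k. root (q + 1) (r k ^ (q + 1))) \<longlonglongrightarrow> root (q + 1) 0"
    by (rule tendsto_real_root)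
  moreover have "root (q + 1) (r k ^ (q + 1)) = r k" for k
    by (rule real_root_power_cancel) auto
  ultimately show ?thesis
    by simp
qed

lemma opt_tendsto_0: "opt \<longlonglongrightarrow> 0"
proof -
  have "(\<lambda>k. C1 * r k ^ p + \<eta>1 * r k ^ min p q + C2 * r k ^ q)
      \<longlonglongrightarrow> C1 * 0 ^ p + \<eta>1 * 0 ^ min p q + C2 * 0 ^ q"
    by (intro tendsto_intros r_tendsto_0)
  moreover have "C1 * 0 ^ p + \<eta>1 * 0 ^ min p q + C2 * 0 ^ q = 0"
    using p q by (simp add: zero_power)
  ultimately have lim: "(\<lambda>k. C1 * r k ^ p + \<eta>1 * r k ^ min p q + C2 * r k ^ q) \<longlonglongrightarrow> 0"
    by simp
  \<comment> \<open>The bound starts at index \<open>1\<close>, since \<open>u 0\<close> and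
    \<open>\<Lambda> 0\<close> belong to no step; a shift does not affect the limit.\<close>
  have "(\<lambda>k. opt (Suc k)) \<longlonglongrightarrow> 0"
    by (rule real_tendsto_sandwich[OF _ _ tendsto_const lim]; rule always_eventually)
       (use opt_nonneg opt_bound in auto)
  then show ?thesis
    by (rule LIMSEQ_imp_Suc)
qed

section \<open>Sublinear rate\<close>

lemma sum_decrease:
  "(\<Sum>j<k. (Mp - Lp) / fact (p + 1) * r j ^ (p + 1)) \<le> Fr 0 - lim Fr"
  "(\<Sum>j<k. M / fact (q + 1) * r j ^ (q + 1)) \<le> Fr 0 - lim Fr"
proof -
  have tele: "(\<Sum>j<k. Fr j - Fr (Suc j)) \<le> Fr 0 - lim Fr"
    using lim_le_Fr[of k] by (simp add: sum_lessThan_telescope')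
  show "(\<Sum>j<k. (Mp - Lp) / fact (p + 1) * r j ^ (p + 1)) \<le> Fr 0 - lim Fr"
    by (rule order_trans[OF sum_mono tele]) (use decrease decrease_terms_nonneg in \<open>smt (verit)\<close>)
  show "(\<Sum>j<k. M / fact (q + 1) * r j ^ (q + 1)) \<le> Fr 0 - lim Fr"
    by (rule order_trans[OF sum_mono tele]) (use decrease decrease_terms_nonneg in \<open>smt (verit)\<close>)
qed

text \<open>Common form of the two cases of the rate: \<open>s = q\<close> with
  \<open>c = M\<close>, and \<open>s = p\<close> with \<open>c = Mp - Lp\<close>.\<close>

lemma Min_opt_le:
  assumes k: "k \<ge> 1" and s: "s \<ge> 1" and c: "c > 0"
    and sum: "(\<Sum>j<k. c / fact (s + 1) * r j ^ (s + 1)) \<le> \<delta>"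
    and E: "E \<ge> 0" "\<And>j. opt (Suc j) \<le> E * r j ^ s"
  shows "Min (opt ` {1..k}) \<le> fact (s + 1) powr (real s / real (s + 1)) * E * \<delta> powr (real s / real (s + 1))
    / c powr (real s / real (s + 1)) / real k powr (real s / real (s + 1))"
proof -
  let ?a = "real s / real (s + 1)"
  obtain j where j: "j < k" "r j ^ s \<le> \<delta> powr ?a / ((c / fact (s + 1)) powr ?a * real k powr ?a)"
    using min_power_rate[OF _ _ s k sum] c by auto
  \<comment> \<open>Step \<open>j\<close> produces the iterate with index \<open>Suc j\<close>,
    which lies in \<open>{1..k}\<close> because \<open>j < k\<close>.\<close>
  have "Min (opt ` {1..k}) \<le> opt (Suc j)"
    using j(1) by (intro Min_le) auto
  also have "\<dots> \<le> E * (\<delta> powr ?a / ((c / fact (s + 1)) powr ?a * real k powr ?a))"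
    using E(2)[of j] mult_left_mono[OF j(2) E(1)] by linarith
  also have "\<dots> = fact (s + 1) powr ?a * E * \<delta> powr ?a / c powr ?a / real k powr ?a"
    using c by (simp add: powr_divide del: fact_Suc)
  finally show ?thesis .
qed

lemma power_le_powr_diff:
  assumes "s \<le> t"
  shows "r j ^ t \<le> (2 * D) powr (real t - real s) * r j ^ s"
proof -
  have "r j ^ t = r j ^ (t - s) * r j ^ s"
    using assms by (simp flip: power_add)
  also have "\<dots> \<le> (2 * D) ^ (t - s) * r j ^ s"
    using r_le by (intro mult_right_mono power_mono) auto
  also have "(2 * D) ^ (t - s) = (2 * D) powr (real t - real s)"
    using D(1) assms powr_realpow[of "2 * D" "t - s"] by (simp only: of_nat_diff)
  finally show ?thesis .
qed

text \<open>The smaller of \<open>p\<close> and \<open>q\<close> decides, since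
  \<open>s / (s + 1)\<close> increases with \<open>s\<close>. The higher power of the step is
  reduced to the lower one, and the two cases yield the two arguments of the maximum in
  \<open>const_C\<close>.\<close>

lemma rate:
  assumes k: "k \<ge> 1"
  shows "Min (opt ` {1..k}) \<le> const_C p q Lp Mp M \<eta>1 D C1 C2 (Fr 0 - lim Fr)
    / real k powr min (real q / real (q + 1)) (real p / real (p + 1))"
proof (cases "q \<le> p")
  case True
  let ?a = "real q / real (q + 1)"
  let ?E = "C1 * (2 * D) powr (real p - real q) + \<eta>1 + C2"
  have "opt (Suc j) \<le> ?E * r j ^ q" for j
    using opt_bound[of j] mult_left_mono[OF power_le_powr_diff[OF True, of j] C1_nonneg] True
    by (simp add: min_absorb2 algebra_simps)
  then have "Min (opt ` {1..k})
      \<le> fact (q + 1) powr ?a * ?E * (Fr 0 - lim Fr) powr ?a / M powr ?a / real k powr ?a"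
    using C1_nonneg C2_nonneg \<eta>(1) by (intro Min_opt_le k q M sum_decrease) auto
  also have "\<dots> \<le> const_C p q Lp Mp M \<eta>1 D C1 C2 (Fr 0 - lim Fr) / real k powr ?a"
    unfolding const_C_def Let_def by (intro divide_right_mono max.cobounded1) auto
  also have "?a = min ?a (real p / real (p + 1))"
    using True by (simp add: min_def field_simps)
  finally show ?thesis .
next
  case False
  let ?b = "real p / real (p + 1)"
  let ?E = "C1 + \<eta>1 + C2 * (2 * D) powr (real q - real p)"
  have "opt (Suc j) \<le> ?E * r j ^ p" for j
    using opt_bound[of j] mult_left_mono[OF power_le_powr_diff[of p q j] C2_nonneg] False
    by (simp add: min_absorb1 algebra_simps)
  then have "Min (opt ` {1..k})
      \<le> fact (p + 1) powr ?b * ?E * (Fr 0 - lim Fr) powr ?b / (Mp - Lp) powr ?b / real k powr ?b"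
    using C1_nonneg C2_nonneg \<eta>(1) Mp by (intro Min_opt_le k p sum_decrease) auto
  also have "\<dots> \<le> const_C p q Lp Mp M \<eta>1 D C1 C2 (Fr 0 - lim Fr) / real k powr ?b"
    unfolding const_C_def Let_def by (intro divide_right_mono max.cobounded2) auto
  also have "?b = min (real q / real (q + 1)) ?b"
    using False by (simp add: min_def field_simps)
  finally show ?thesis .
qed

end

theorem theorem4p3:
  fixes B :: "'a::euclidean_space \<Rightarrow> 'a \<Rightarrow>\<^sub>L real"
    and p q m :: nat
    and F0 :: "'a \<Rightarrow> real" and Fc :: "nat \<Rightarrow> 'a \<Rightarrow> real" and h :: "'a \<Rightarrow> ereal"
    and Lp Mp M \<eta>1 \<eta>2 \<eta>3 D Cu :: real and Lq Mq :: "nat \<Rightarrow> real"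
    and x :: "nat \<Rightarrow> 'a" and u :: "nat \<Rightarrow> nat \<Rightarrow> real"
  assumes "pos_def_operator B"
    and "p \<ge> 1" and "q \<ge> 1" and "m \<ge> 1"
    and "smoothness_assumption B p q m Lp Lq F0 Fc h"
    and "level_set_assumption m F0 Fc h"
    and "mfcq m Fc"
    and "\<eta>1 > 0" and "\<eta>2 > 0" and "\<eta>3 > 0"
    and "Mp > Lp" and "M > 0" and "\<forall>i \<in> {1..m}. Mq i \<ge> Lq i + \<eta>3"
    and "mta_sequence B p q m Mp M Mq \<eta>1 \<eta>2 \<eta>3 F0 Fc h x u"
    and "D > 0" and "\<forall>k. pnorm B (x k) \<le> D"
    and "Cu > 0" and "\<forall>k \<ge> 1. L2_set (u k) {1..m} \<le> Cu"
  shows "\<exists>\<Lambda> :: nat \<Rightarrow> 'a \<Rightarrow>\<^sub>L real.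
    let \<M> = (\<lambda>k. opt_measure B q m F0 Fc (x k) (u k) (\<Lambda> k));
        C1 = const_C1 p Lp Mp;
        C2 = const_C2 q m Lq Mq M \<eta>2 Cu;
        Finf = lim (\<lambda>k. objective F0 h (x k));
        C = const_C p q Lp Mp M \<eta>1 D C1 C2 (real_of_ereal (objective F0 h (x 0) - Finf))
    in (\<forall>k. \<Lambda> (Suc k) \<in> subdiff h (x (Suc k))) \<and>
       (\<forall>k. \<M> (Suc k) \<le> C1 * pnorm B (x (Suc k) - x k) ^ p
                       + \<eta>1 * pnorm B (x (Suc k) - x k) ^ min p q
                       + C2 * pnorm B (x (Suc k) - x k) ^ q) \<and>
       (\<forall>k. x (Suc k) = x k \<longrightarrow> x k \<in> kkt_points m F0 Fc h) \<and>
       \<M> \<longlonglongrightarrow> 0 \<and>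
       (\<forall>k \<ge> 1. Min (\<M> ` {1..k})
                 \<le> C / real k powr min (real q / real (q + 1)) (real p / real (p + 1)))"
proof -
  note seq = assms(14)[unfolded mta_sequence_def]
  obtain \<Lambda>' where \<Lambda>':
    "\<And>k. a_kkt B p q m Mp M Mq \<eta>1 \<eta>2 \<eta>3 F0 Fc h (x k) (x (Suc k)) (u (Suc k)) (\<Lambda>' k)"
    using seq by metis
  \<comment> \<open>The choice \<open>\<Lambda>' k\<close> belongs to \<open>x (Suc k)\<close>; the
    shift aligns the index with the iterate, and \<open>\<Lambda> 0\<close> takes the filler value
    \<open>\<Lambda>' 0\<close>.\<close>
  define \<Lambda> where "\<Lambda> = (\<lambda>k. \<Lambda>' (k - 1))"
  interpret mta B p q m F0 Fc h Lp Mp M \<eta>1 \<eta>2 \<eta>3 D Cu Lq Mq x u \<Lambda>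
    using assms seq \<Lambda>' by unfold_locales (auto simp: \<Lambda>_def)
  have eq: "real_of_ereal (objective F0 h (x 0) - lim (\<lambda>k. objective F0 h (x k))) = Fr 0 - lim Fr"
    unfolding lim_objective by (simp add: objective_eq)
  show ?thesis
    unfolding Let_def eq
    by (intro exI[of _ \<Lambda>] conjI allI impI subgradient opt_bound kkt_of_fixed_point opt_tendsto_0 rate)
qed

end
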